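(* Let $\psi:S^1\to\mathbb{R}$ be a $C^2$ function whose critical set $C'_\psi=\{\hat x\in S^1:\psi'(\hat x)=0\}$ is finite and such that $\psi''(\hat x)\neq 0$ for every $\hat x\in C'_\psi$. Let $\beta,c\in(0,1)$. Then there is $L_0>0$, depending only on $\psi,\beta,c$, such that the following holds for every $L\ge L_0$. Let $a\in[0,1)$ and $k\in\mathbb{N}$ (arbitrary) be such that $f=f_{L,a}=L\psi+a\ (\mathrm{mod}\ 1)$ satisfies $$d(f^l(\hat x),C'_\psi)\ge c\qquad\text{for all }\hat x\in C'_\psi\text{ and all }1\le l\le k,$$ and let $\epsilon\ge L^{-(2k+1)(1-\beta)}$. Then the random composition $f^n_{\underline\omega}$ (with noise amplitude $\epsilon$) admits a unique (hence ergodic) stationary probability measure $\mu$, and $\mu$ is supported on all of $S^1$.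
   Context: $S^1=\mathbb{R}/\mathbb{Z}$, parametrized by $[0,1)$, with the metric $d(x,y)=\min\{|x-y|,|x-y\pm1|\}$; for a set $A$, $d(x,A)=\inf_{y\in A}d(x,y)$. Given $\epsilon>0$, let $\nu^\epsilon$ be the uniform distribution on $[-\epsilon,\epsilon]$, $\Omega=[-\epsilon,\epsilon]^{\mathbb{Z}_{\ge0}}$ with elements $\underline\omega=(\omega_0,\omega_1,\dots)$, and $\mathbb{P}=(\nu^\epsilon)^{\otimes\mathbb{Z}_{\ge0}}$. For $\omega\in[-\epsilon,\epsilon]$ put $f_\omega(x)=f(x+\omega)$ (argument taken mod 1), and $f^n_{\underline\omega}=f_{\omega_{n-1}}\circ\cdots\circ f_{\omega_0}$. The associated Markov chain on $S^1$ is $X_{n+1}=f_{\omega_n}(X_n)$, with transition kernel $P(x,B)=\nu^\epsilon\{\omega\in[-\epsilon,\epsilon]:f_\omega(x)\in B\}$. A Borel probability measure $\mu$ on $S^1$ is stationary if $\mu(B)=\int_{S^1}P(x,B)\,d\mu(x)$ for all Borel $B\subset S^1$. *)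

theory Defs
  imports "HOL-Probability.Probability"
begin

typedef circle = "{0..<1::real}"
  morphisms coord Abs_circle
  by (rule exI[of _ 0]) simp

definition circle_of :: "real \<Rightarrow> circle" where
  "circle_of t = Abs_circle (frac t)"

lemma coord_bounds: "0 \<le> coord x" "coord x < 1"
  using coord[of x] by auto

lemma coord_circle_of: "coord (circle_of t) = frac t"
  unfolding circle_of_def by (rule Abs_circle_inverse) (simp add: frac_lt_1)

lemma circle_of_coord: "circle_of (coord x) = x"
  by (simp add: circle_of_def frac_eq coord_bounds coord_inverse)

instantiation circle :: metric_space
begin

definition dist_circle :: "circle \<Rightarrow> circle \<Rightarrow> real" where
  "dist_circle x y = Min {\<bar>coord x - coord y\<bar>, \<bar>coord x - coord y + 1\<bar>, \<bar>coord x - coord y - 1\<bar>}"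

definition uniformity_circle :: "(circle \<times> circle) filter" where
  "uniformity_circle = (INF e\<in>{0 <..}. principal {(x, y). dist x y < e})"

definition open_circle :: "circle set \<Rightarrow> bool" where
  "open_circle U \<longleftrightarrow> (\<forall>x\<in>U. eventually (\<lambda>(x', y). x' = x \<longrightarrow> y \<in> U) uniformity)"

instance
proof
  fix x y z :: circle
  show "dist x y = 0 \<longleftrightarrow> x = y"
  proof
    assume "dist x y = 0"
    then have "coord x = coord y"
      using coord_bounds[of x] coord_bounds[of y]
      by (auto simp: dist_circle_def min_def split: if_splits)
    then show "x = y" by (simp add: coord_inject)
  qed (simp add: dist_circle_def)
  show "dist x y \<le> dist x z + dist y z"
    using coord_bounds[of x] coord_bounds[of y] coord_bounds[of z]
    by (simp add: dist_circle_def min_def abs_if)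
qed (rule uniformity_circle_def open_circle_def)+

end

text \<open>
  The metric above is the quotient metric of the real line modulo the integers, and
  \<^const>\<open>circle_of\<close> is reduction mod 1.
  Calculus on the circle is calculus of the 1-periodic lift \<open>\<lambda>t. \<psi> (circle_of t)\<close>.
\<close>

definition circle_differentiable :: "(circle \<Rightarrow> real) \<Rightarrow> bool" where
  "circle_differentiable \<psi> \<longleftrightarrow> (\<forall>t. (\<lambda>s. \<psi> (circle_of s)) differentiable at t)"

definition circle_deriv :: "(circle \<Rightarrow> real) \<Rightarrow> circle \<Rightarrow> real" where
  "circle_deriv \<psi> x = deriv (\<lambda>s. \<psi> (circle_of s)) (coord x)"

definition circle_C2 :: "(circle \<Rightarrow> real) \<Rightarrow> bool" where
  "circle_C2 \<psi> \<longleftrightarrow> circle_differentiable \<psi> \<and> circle_differentiable (circle_deriv \<psi>) \<and>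
     continuous_on UNIV (circle_deriv (circle_deriv \<psi>))"

definition critical_set :: "(circle \<Rightarrow> real) \<Rightarrow> circle set" where
  "critical_set \<psi> = {x. circle_deriv \<psi> x = 0}"

definition circle_map :: "(circle \<Rightarrow> real) \<Rightarrow> real \<Rightarrow> real \<Rightarrow> circle \<Rightarrow> circle" where
  "circle_map \<psi> L a x = circle_of (L * \<psi> x + a)"

definition perturbed :: "(circle \<Rightarrow> circle) \<Rightarrow> real \<Rightarrow> circle \<Rightarrow> circle" where
  "perturbed f w x = f (circle_of (coord x + w))"

definition noise :: "real \<Rightarrow> real measure" where
  "noise \<epsilon> = uniform_measure lborel {-\<epsilon>..\<epsilon>}"

definition transition :: "(circle \<Rightarrow> circle) \<Rightarrow> real \<Rightarrow> circle \<Rightarrow> circle set \<Rightarrow> ennreal" where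
  "transition f \<epsilon> x B = emeasure (noise \<epsilon>) {w \<in> {-\<epsilon>..\<epsilon>}. perturbed f w x \<in> B}"

definition stationary :: "(circle \<Rightarrow> circle) \<Rightarrow> real \<Rightarrow> circle measure \<Rightarrow> bool" where
  "stationary f \<epsilon> \<mu> \<longleftrightarrow> prob_space \<mu> \<and> sets \<mu> = sets borel \<and>
     (\<forall>B \<in> sets borel. emeasure \<mu> B = (\<integral>\<^sup>+ x. transition f \<epsilon> x B \<partial>\<mu>))"

text \<open>
  Ergodicity of a stationary measure in the sense of Markov chains: almost surely invariant
  sets are trivial.
\<close>

definition ergodic_stationary :: "(circle \<Rightarrow> circle) \<Rightarrow> real \<Rightarrow> circle measure \<Rightarrow> bool" where
  "ergodic_stationary f \<epsilon> \<mu> \<longleftrightarrow> stationary f \<epsilon> \<mu> \<and>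
     (\<forall>B \<in> sets borel. (AE x in \<mu>. transition f \<epsilon> x B = indicator B x) \<longrightarrow>
        emeasure \<mu> B = 0 \<or> emeasure \<mu> B = 1)"

definition measure_support :: "'a::topological_space measure \<Rightarrow> 'a set" where
  "measure_support \<mu> = {x. \<forall>U. open U \<and> x \<in> U \<longrightarrow> emeasure \<mu> U > 0}"

end

theory Submission
  imports Defs
begin

text \<open>
  The proof separates a deterministic statement about reachability from a soft probabilistic
  argument.

  \<^bold>\<open>Reachability.\<close> The key is \<open>noisy_map_minimal\<close>: a nonempty set that is mapped into itself by
  every \<^term>\<open>perturbed f w\<close> with \<open>\<bar>w\<bar> \<le> \<epsilon>\<close> is the whole circle. Lift \<open>f\<close> to
  \<open>F t = L * \<psi> (circle_of t) + a\<close> on the line and let \<open>E\<close> be the \<open>\<epsilon>\<close>-neighbourhood of the lifted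
  set, so that \<open>E\<close> contains the \<open>\<epsilon>\<close>-neighbourhood of its own image. It suffices that \<open>E\<close> contains
  an interval of some fixed length, since away from the critical points \<open>F\<close> expands by a factor
  of order \<open>L\<close>. Put \<open>e = L powr (\<beta> - 1)\<close>, where without loss \<open>\<beta> \<le> 1 / 4\<close>; the noise has size at least \<open>e ^ (2 * k + 1)\<close>, and the
  decisive length is \<open>\<rho> = e ^ (k + 1)\<close>.
  An interval at distance \<open>r\<close> from a critical point \<open>x\<close> is expanded by about \<open>L * r\<close>; afterwards it
  follows the orbit of \<open>F x\<close>, which stays away from the critical set for \<open>k\<close> steps, and expands by
  about \<open>L\<close> at each step until its distance to that orbit, initially of order \<open>L * r\<^sup>2\<close>, is no
  longer small. If this takes \<open>i < k\<close> steps, then \<open>r\<close> is of order \<open>L powr (- (i + 1) / 2)\<close> and the total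
  gain is of order \<open>L powr ((i + 1) / 2)\<close>; if it takes all \<open>k\<close> steps, the gain is of order
  \<open>L ^ (k + 1) * r\<close>, which is large when \<open>r\<close> is at least of order \<open>\<rho>\<close> (\<open>return_expansion\<close>).
  Hence lengths double unless \<open>E\<close> comes closer than about \<open>\<rho>\<close> to a critical point \<open>x\<close>. But then \<open>E\<close> contains a
  point near \<open>F x\<close>, hence by noise an interval of length \<open>e ^ (2 * k + 1)\<close> around it, and \<open>k\<close>
  expanding steps along the orbit of \<open>F x\<close> make it at least \<open>\<rho>\<close> long (\<open>noise_expansion\<close>). From
  length \<open>\<rho>\<close> on, lengths double until they reach a fixed size. This uses the noise after the passage near the
  critical point, which is why \<open>k\<close> free steps are worth an exponent \<open>2 * k + 1\<close>.

  \<^bold>\<open>Probability.\<close> The transition kernel \<open>K\<close> dominates \<open>s x * \<nu>\<close>, where \<open>\<nu>\<close> is one noisy step with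
  half the amplitude from a base point and \<open>s\<close> is a continuous bump around that point. Whenever
  the chain makes a step, it may be regarded as restarting from \<open>\<nu>\<close> with probability \<open>s x\<close>; the
  remaining sub-Markov kernel is \<open>K x - s x * \<nu>\<close>. The probability of no restart in \<open>n\<close> steps
  is a continuous function of the starting point, and the set where it equals 1 for all \<open>n\<close> is forward
  invariant, hence empty by minimality. By compactness the restart happens within a bounded time
  with probability bounded below. Then the expected occupation measure of one excursion from
  \<open>\<nu>\<close> is finite and, normalized, is the only stationary measure (locale \<open>regenerative_kernel\<close>).
  Its support is nonempty and forward invariant, so minimality gives full support, and
  ergodicity follows from uniqueness because conditioning on an almost invariant set preserves
  stationarity.
\<close>

section \<open>The circle as a quotient of the line\<close>

lemma circle_of_eq_iff: "circle_of s = circle_of t \<longleftrightarrow> (\<exists>n::int. s = t + of_int n)"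
proof
  assume "circle_of s = circle_of t"
  then have "frac s = frac t" by (metis coord_circle_of)
  then have "s = t + of_int (\<lfloor>s\<rfloor> - \<lfloor>t\<rfloor>)" by (simp add: frac_def)
  then show "\<exists>n::int. s = t + of_int n" by blast
qed (auto simp: circle_of_def frac_def)

lemma circle_of_add_int [simp]: "circle_of (t + of_int n) = circle_of t"
  by (auto simp: circle_of_eq_iff)

lemma circle_of_coord_add [simp]: "circle_of (coord (circle_of t) + w) = circle_of (t + w)"
proof -
  have "coord (circle_of t) + w = (t + w) + of_int (- \<lfloor>t\<rfloor>)"
    by (simp add: coord_circle_of frac_def)
  then show ?thesis by (simp only: circle_of_add_int)
qed

lemma dist_circle_of_le: "dist (circle_of s) (circle_of t) \<le> \<bar>s - t\<bar>"
proof (cases "\<bar>s - t\<bar> < 1")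
  case True
  define m where "m = \<lfloor>t\<rfloor> - \<lfloor>s\<rfloor>"
  have m: "frac s - frac t = s - t + of_int m"
    by (simp add: m_def frac_def)
  have "\<bar>frac s - frac t\<bar> < 1"
    using frac_ge_0[of s] frac_ge_0[of t] frac_lt_1[of s] frac_lt_1[of t] by linarith
  with m True have "\<bar>real_of_int m\<bar> < 2" by linarith
  then have "m = - 1 \<or> m = 0 \<or> m = 1" by linarith
  with m show ?thesis
    by (auto simp: dist_circle_def coord_circle_of)
next
  case False
  have "\<bar>frac s - frac t\<bar> < 1"
    using frac_ge_0[of s] frac_ge_0[of t] frac_lt_1[of s] frac_lt_1[of t] by linarith
  then have "dist (circle_of s) (circle_of t) < 1"
    by (simp add: dist_circle_def coord_circle_of)
  with False show ?thesis by linarith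
qed

text \<open>
  Points of the circle have lifts at the right distance; this transfers local arguments from
  the line to the circle, where \<^const>\<open>coord\<close> itself is discontinuous.
\<close>

lemma dist_circle_lift:
  obtains \<delta> where "\<bar>\<delta>\<bar> = dist x y" "y = circle_of (coord x + \<delta>)"
proof -
  have "\<exists>n\<in>{-1, 0, 1::int}. \<bar>coord x - coord y + of_int n\<bar> = dist x y"
    using coord_bounds[of x] coord_bounds[of y]
    by (auto simp: dist_circle_def min_def)
  then obtain n :: int where n: "\<bar>coord x - coord y + of_int n\<bar> = dist x y" by blast
  have "coord x + - (coord x - coord y + of_int n) = coord y + of_int (- n)" by simp
  then have "circle_of (coord x + - (coord x - coord y + of_int n)) = y"
    by (metis circle_of_add_int circle_of_coord)
  with n that[of "- (coord x - coord y + of_int n)"] show ?thesis by auto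
qed

lemma continuous_on_circle_of: "continuous_on S circle_of"
proof (rule continuous_on_subset)
  show "continuous_on UNIV circle_of"
    unfolding continuous_on_iff
    by (metis UNIV_I dist_circle_of_le dist_real_def le_less_trans)
qed simp

lemma range_circle_of_unit: "circle_of ` {0..1} = UNIV"
proof -
  have "x \<in> circle_of ` {0..1}" for x
    using coord_bounds[of x] circle_of_coord[of x] by (intro image_eqI[of _ _ "coord x"]) auto
  then show ?thesis by auto
qed

lemma compact_UNIV_circle: "compact (UNIV :: circle set)"
  using compact_continuous_image[OF continuous_on_circle_of compact_Icc[of 0 1]]
  by (simp add: range_circle_of_unit)

lemma circle_of_Icc_eq_UNIV:
  assumes "q - p \<ge> 1"
  shows "circle_of ` {p..q} = UNIV"
proof -
  have "x \<in> circle_of ` {p..q}" for x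
  proof -
    define t where "t = p + frac (coord x - p)"
    have "t = coord x + of_int (- \<lfloor>coord x - p\<rfloor>)" by (simp add: t_def frac_def)
    then have "circle_of t = x" by (metis circle_of_add_int circle_of_coord)
    moreover have "t \<in> {p..q}"
      using frac_ge_0[of "coord x - p"] frac_lt_1[of "coord x - p"] assms by (auto simp: t_def)
    ultimately show ?thesis by blast
  qed
  then show ?thesis by auto
qed

lemma dist_rotate_le:
  "dist (circle_of (coord x + w)) (circle_of (coord y + w)) \<le> dist x y"
proof -
  obtain \<delta> where d: "\<bar>\<delta>\<bar> = dist x y" "y = circle_of (coord x + \<delta>)"
    by (rule dist_circle_lift)
  have "dist (circle_of (coord x + w)) (circle_of (coord x + \<delta> + w)) \<le> \<bar>\<delta>\<bar>"
    using dist_circle_of_le[of "coord x + w" "coord x + \<delta> + w"] by simp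
  with d show ?thesis by simp
qed

lemma continuous_on_rotate: "continuous_on S (\<lambda>x. circle_of (coord x + w))"
  unfolding continuous_on_iff by (metis dist_rotate_le le_less_trans)

text \<open>
  The coordinate jumps at the base point only, so for \<open>y > 0\<close> its superlevel set is a compact arc
  without that point.
\<close>

lemma borel_measurable_coord [measurable]: "coord \<in> borel_measurable borel"
proof (rule borel_measurableI_ge)
  fix y :: real
  have "{x. y \<le> coord x} \<in> sets borel"
  proof (cases "y \<le> 0")
    case True
    then have "{x. y \<le> coord x} = UNIV" using coord_bounds order_trans by blast
    then show ?thesis by simp
  next
    case False
    have "{x. y \<le> coord x} = circle_of ` {y..1} - {circle_of 0}"
    proof (intro set_eqI iffI)
      fix x assume "x \<in> {x. y \<le> coord x}"
      then have x: "y \<le> coord x" by simp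
      then have "x \<in> circle_of ` {y..1}"
        using coord_bounds[of x] circle_of_coord[of x]
        by (intro image_eqI[of _ _ "coord x"]) auto
      moreover have "x \<noteq> circle_of 0" using x False by (auto simp: coord_circle_of)
      ultimately show "x \<in> circle_of ` {y..1} - {circle_of 0}" by blast
    next
      fix x assume "x \<in> circle_of ` {y..1} - {circle_of 0}"
      then obtain t where t: "y \<le> t" "t \<le> 1" "x = circle_of t" "x \<noteq> circle_of 0" by auto
      have "t \<noteq> 1" using t circle_of_add_int[of 0 1] by auto
      then have "frac t = t" using t False by (simp add: frac_eq)
      then show "x \<in> {x. y \<le> coord x}" using t by (simp add: coord_circle_of)
    qed
    moreover have "closed (circle_of ` {y..1})"
      by (intro compact_imp_closed compact_continuous_image continuous_on_circle_of compact_Icc)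
    ultimately show ?thesis by auto
  qed
  then show "{x \<in> space borel. y \<le> coord x} \<in> sets borel" by simp
qed

lemma borel_measurable_circle_of [measurable]: "circle_of \<in> borel_measurable borel"
  by (rule borel_measurable_continuous_onI[OF continuous_on_circle_of])

section \<open>Calculus on the circle\<close>

lemma deriv_circle_lift:
  assumes "circle_differentiable \<phi>"
  shows "((\<lambda>s. \<phi> (circle_of s)) has_real_derivative circle_deriv \<phi> (circle_of t)) (at t)"
proof -
  have "(\<lambda>s. \<phi> (circle_of s)) field_differentiable at (frac t)"
    using assms unfolding circle_differentiable_def
    by (simp add: field_differentiable_def real_differentiable_def)
  then have "((\<lambda>s. \<phi> (circle_of s)) has_real_derivative circle_deriv \<phi> (circle_of t)) (at (frac t))"
    unfolding circle_deriv_def coord_circle_of by (rule field_differentiable_derivI)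
  then have "((\<lambda>s. \<phi> (circle_of s)) has_real_derivative circle_deriv \<phi> (circle_of t))
      (at (t + - of_int \<lfloor>t\<rfloor>))"
    by (simp add: frac_def)
  then have "((\<lambda>s. \<phi> (circle_of (s + - of_int \<lfloor>t\<rfloor>))) has_real_derivative
      circle_deriv \<phi> (circle_of t)) (at t)"
    by (subst (asm) DERIV_shift)
  moreover have "circle_of (s + - of_int \<lfloor>t\<rfloor>) = circle_of s" for s
    using circle_of_add_int[of s "- \<lfloor>t\<rfloor>"] by simp
  ultimately show ?thesis by simp
qed

section \<open>Growth of intervals\<close>

text \<open>
  Used with \<open>P l\<close> meaning that an invariant set contains an interval of length \<open>l\<close>.
\<close>

lemma doubling_reaches:
  fixes P :: "real \<Rightarrow> bool"
  assumes "P l" "0 < l" "l \<le> T"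
    and down: "\<And>x y. P y \<Longrightarrow> 0 < x \<Longrightarrow> x \<le> y \<Longrightarrow> P x"
    and double: "\<And>x. P x \<Longrightarrow> l \<le> x \<Longrightarrow> x < T \<Longrightarrow> P (2 * x)"
  shows "P T"
proof -
  have *: "P (min (2 ^ n * l) T)" for n
  proof (induction n)
    case 0
    then show ?case using assms by simp
  next
    case (Suc n)
    show ?case
    proof (cases "2 ^ n * l < T")
      case True
      have "l \<le> 2 ^ n * l" using \<open>0 < l\<close> by simp
      then have "P (2 * (2 ^ n * l))"
        using Suc True by (intro double) auto
      then show ?thesis
        by (rule down) (use \<open>0 < l\<close> \<open>l \<le> T\<close> in auto)
    next
      case False
      then have "P T" using Suc by (simp add: min_absorb2)
      moreover have "2 ^ Suc n * l = 2 * (2 ^ n * l)" "0 < 2 ^ n * l" using \<open>0 < l\<close> by simp_all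
      then have "min (2 ^ Suc n * l) T = T" using False by linarith
      ultimately show ?thesis by simp
    qed
  qed
  obtain n where "T / l < 2 ^ n" using real_arch_pow[of 2 "T / l"] by auto
  then have "T \<le> 2 ^ n * l" using \<open>0 < l\<close> by (simp add: field_simps)
  with *[of n] show ?thesis by (simp add: min_absorb2)
qed

lemma interval_in_closed_segment:
  fixes u v l :: real
  assumes "closed_segment u v \<subseteq> E" "l \<le> \<bar>u - v\<bar>"
  shows "\<exists>q. {q..q + l} \<subseteq> E"
proof -
  have "{min u v..min u v + l} \<subseteq> closed_segment u v"
    using assms(2) by (auto simp: closed_segment_eq_real_ivl min_def)
  with assms(1) show ?thesis by blast
qed

text \<open>
  If an orbit segment of length \<open>n\<close> ends because the deviation \<open>(L * M) ^ n * r\<^sup>2\<close> has become of order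
  one, then \<open>r\<close> is at least of order \<open>(L * M) powr (- n / 2)\<close>, while the expansion \<open>(L * \<theta>) ^ n\<close> gained
  meanwhile outweighs this: the square of the product is at least a multiple of
  \<open>(L * \<theta>\<^sup>2 / M) ^ n\<close>.
\<close>

lemma balanced_expansion_gain:
  fixes L \<theta> M c r :: real
  assumes "0 < L" "0 < \<theta>" "0 < M" "0 < c" "c \<le> 1" "0 < r" "0 < n"
    and large: "512 * M \<le> c * L * \<theta>\<^sup>2"
    and far: "c \<le> 8 * (L * M) ^ n * r\<^sup>2"
  shows "8 \<le> (L * \<theta>) ^ n * r"
proof -
  define q where "q = L * \<theta>\<^sup>2 / M"
  have q: "512 \<le> c * q" using large \<open>0 < M\<close> by (simp add: q_def field_simps)
  have "0 < q" using assms by (simp add: q_def)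
  then have "c * q \<le> 1 * q" using \<open>c \<le> 1\<close> by (intro mult_right_mono) auto
  with q have "1 \<le> q" by simp
  then have "q \<le> q ^ n" using \<open>0 < n\<close> by (rule self_le_power)
  then have "c * q \<le> c * q ^ n" using \<open>0 < c\<close> by simp
  with q have "512 \<le> c * q ^ n" by simp
  also have "\<dots> \<le> 8 * (L * M) ^ n * r\<^sup>2 * q ^ n"
    using far \<open>0 < q\<close> by (intro mult_right_mono) auto
  also have "\<dots> = 8 * r\<^sup>2 * (L * M * q) ^ n" by (simp add: power_mult_distrib)
  also have "L * M * q = (L * \<theta>)\<^sup>2" using \<open>0 < M\<close> by (simp add: q_def power2_eq_square)
  also have "8 * r\<^sup>2 * ((L * \<theta>)\<^sup>2) ^ n = 8 * ((L * \<theta>) ^ n * r)\<^sup>2"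
    by (simp add: power_mult_distrib power_mult[symmetric] mult.commute)
  finally have "8\<^sup>2 \<le> ((L * \<theta>) ^ n * r)\<^sup>2" by simp
  then show ?thesis
    by (rule power2_le_imp_le) (use assms in simp)
qed

text \<open>
  The lift \<open>F\<close> has critical set \<open>C\<close>, derivative at least \<open>L * \<kappa>\<close> times the distance to \<open>C\<close>, and
  Lipschitz constant \<open>L * M\<close>. The quantity \<open>e\<close> stands for \<open>L powr (\<beta> - 1)\<close>: then
  \<open>e * L = L powr \<beta>\<close> is large, and \<open>L * e\<^sup>2 = L powr (2 * \<beta> - 1)\<close> is small as long as \<open>\<beta> < 1 / 2\<close>.
  Expressing all scales as powers of \<open>e\<close> keeps real exponents out of the estimates.
\<close>

locale expanding_lift =
  fixes F F' :: "real \<Rightarrow> real" and C :: "real set" and L \<kappa> M c \<sigma> e :: real and k :: nat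
  assumes deriv: "\<And>t. (F has_real_derivative F' t) (at t)"
    and expand: "\<And>t. L * \<kappa> * infdist t C \<le> \<bar>F' t\<bar>"
    and lipschitz: "\<And>s t. \<bar>F s - F t\<bar> \<le> L * M * \<bar>s - t\<bar>"
    and quadratic: "\<And>s t. s \<in> C \<Longrightarrow> \<bar>F t - F s\<bar> \<le> L * M * \<bar>t - s\<bar>\<^sup>2"
    and closed_C: "closed C" and C_nonempty: "C \<noteq> {}"
    and separated: "\<And>s t. s \<in> C \<Longrightarrow> t \<in> C \<Longrightarrow> s \<noteq> t \<Longrightarrow> \<sigma> \<le> \<bar>s - t\<bar>"
    and orbit: "\<And>s l. s \<in> C \<Longrightarrow> 1 \<le> l \<Longrightarrow> l \<le> k \<Longrightarrow> c \<le> infdist ((F ^^ l) s) C"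
    and pos: "0 < L" "0 < \<kappa>" "1 \<le> M" "0 < c" "c < 1" "0 < \<sigma>" "0 < e"
    and LM: "1 \<le> L * M"
    and e_small: "16 * e \<le> c"
    and eL_large: "32 \<le> e * L * (\<kappa> * c / 2)"
    and Le2_small: "L * M * e\<^sup>2 \<le> 1"
    and L_large: "512 * M \<le> c * L * (\<kappa> * c / 2)\<^sup>2" "64 \<le> L * \<kappa> * \<sigma>\<^sup>2"
begin

abbreviation \<theta> :: real where "\<theta> \<equiv> \<kappa> * c / 2"

lemma \<theta>_pos: "0 < \<theta>" and \<theta>_le: "\<theta> \<le> \<kappa>"
  using pos mult_left_le[of c \<kappa>] by simp_all

text \<open>
  Only endpoints are followed under iteration: by the intermediate value theorem the image of a
  segment contains the segment between the images, and by the mean value theorem the distance of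
  the endpoints grows.
\<close>

lemma segment_image:
  assumes far: "\<And>t. t \<in> closed_segment u v \<Longrightarrow> \<delta> \<le> infdist t C"
  shows "closed_segment (F u) (F v) \<subseteq> F ` closed_segment u v"
    and "L * \<kappa> * \<delta> * \<bar>u - v\<bar> \<le> \<bar>F u - F v\<bar>"
proof -
  have "continuous_on (closed_segment u v) F"
    using deriv by (meson DERIV_isCont continuous_at_imp_continuous_on)
  then have "connected (F ` closed_segment u v)"
    by (intro connected_continuous_image connected_segment)
  then have "convex (F ` closed_segment u v)"
    by (metis is_interval_connected_1 is_interval_convex_1)
  then show "closed_segment (F u) (F v) \<subseteq> F ` closed_segment u v"
    by (intro closed_segment_subset) auto
  have mvt: "L * \<kappa> * \<delta> * \<bar>p - q\<bar> \<le> \<bar>F p - F q\<bar>"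
    if "p < q" "{p..q} \<subseteq> closed_segment u v" for p q
  proof -
    obtain z where z: "p < z" "z < q" "F q - F p = (q - p) * F' z"
      using MVT2[OF \<open>p < q\<close>, of F F'] deriv by blast
    have "\<delta> \<le> infdist z C" using z that by (intro far) auto
    then have "L * \<kappa> * \<delta> \<le> \<bar>F' z\<bar>"
      using pos expand[of z] by (meson mult_left_mono mult_pos_pos less_imp_le order_trans)
    then have "L * \<kappa> * \<delta> * \<bar>p - q\<bar> \<le> \<bar>F' z\<bar> * \<bar>p - q\<bar>"
      by (rule mult_right_mono) simp
    also have "\<dots> = \<bar>F p - F q\<bar>"
      using z by (metis abs_minus_commute abs_mult mult.commute)
    finally show ?thesis .
  qed
  consider "u < v" | "v < u" | "u = v" by linarith
  then show "L * \<kappa> * \<delta> * \<bar>u - v\<bar> \<le> \<bar>F u - F v\<bar>"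
  proof cases
    case 1 then show ?thesis using mvt[of u v] by (auto simp: closed_segment_eq_real_ivl)
  next
    case 2 then show ?thesis using mvt[of v u]
      by (auto simp: closed_segment_eq_real_ivl abs_minus_commute)
  qed simp
qed

text \<open>
  As long as both endpoints are within \<open>c / 2\<close> of an orbit that keeps distance \<open>c\<close> from the critical
  set, the whole segment keeps distance \<open>c / 2\<close>, so every step expands by at least
  \<open>L * \<theta>\<close>; the last two estimates are the induction hypothesis that controls how fast the
  endpoints leave the orbit.
\<close>

lemma shadow_orbit:
  assumes E: "\<And>t. t \<in> E \<Longrightarrow> F t \<in> E"
    and orb: "\<And>j. j < i \<Longrightarrow> c \<le> infdist ((F ^^ j) y) C"
    and D: "\<And>j. j < i \<Longrightarrow> (L * M) ^ j * D \<le> c / 2"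
    and near: "\<bar>u - y\<bar> \<le> D" "\<bar>v - y\<bar> \<le> D"
    and seg: "closed_segment u v \<subseteq> E"
  shows "closed_segment ((F ^^ i) u) ((F ^^ i) v) \<subseteq> E \<and>
     (L * \<theta>) ^ i * \<bar>u - v\<bar> \<le> \<bar>(F ^^ i) u - (F ^^ i) v\<bar> \<and>
     \<bar>(F ^^ i) u - (F ^^ i) y\<bar> \<le> (L * M) ^ i * D \<and> \<bar>(F ^^ i) v - (F ^^ i) y\<bar> \<le> (L * M) ^ i * D"
  using orb D
proof (induction i)
  case 0
  then show ?case using near seg by simp
next
  case (Suc i)
  define u' v' y' where "u' = (F ^^ i) u" and "v' = (F ^^ i) v" and "y' = (F ^^ i) y"
  have IH: "closed_segment u' v' \<subseteq> E" "(L * \<theta>) ^ i * \<bar>u - v\<bar> \<le> \<bar>u' - v'\<bar>"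
    "\<bar>u' - y'\<bar> \<le> (L * M) ^ i * D" "\<bar>v' - y'\<bar> \<le> (L * M) ^ i * D"
    using Suc unfolding u'_def v'_def y'_def by auto
  have half: "(L * M) ^ i * D \<le> c / 2" using Suc.prems(2)[of i] by simp
  have cy: "c \<le> infdist y' C" using Suc.prems(1)[of i] by (simp add: y'_def)
  have far: "c / 2 \<le> infdist t C" if "t \<in> closed_segment u' v'" for t
  proof -
    have "\<bar>t - y'\<bar> \<le> c / 2"
    proof -
      have "\<bar>u' - y'\<bar> \<le> c / 2" "\<bar>v' - y'\<bar> \<le> c / 2" using IH(3,4) half by linarith+
      moreover have "min u' v' \<le> t" "t \<le> max u' v'"
        using that by (auto simp: closed_segment_eq_real_ivl split: if_splits)
      ultimately show ?thesis by linarith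
    qed
    moreover have "infdist y' C \<le> infdist t C + dist y' t" by (rule infdist_triangle)
    ultimately show ?thesis using cy by (simp add: dist_real_def abs_minus_commute)
  qed
  note img = segment_image[OF far]
  have "F ` closed_segment u' v' \<subseteq> E" using IH(1) E by blast
  then have 1: "closed_segment (F u') (F v') \<subseteq> E" using img(1) by blast
  have "(L * \<theta>) ^ Suc i * \<bar>u - v\<bar> = L * \<theta> * ((L * \<theta>) ^ i * \<bar>u - v\<bar>)" by simp
  also have "\<dots> \<le> L * \<theta> * \<bar>u' - v'\<bar>"
    using IH(2) \<theta>_pos pos by (intro mult_left_mono) auto
  also have "\<dots> \<le> \<bar>F u' - F v'\<bar>" using img(2) by (simp add: mult_ac)
  finally have 2: "(L * \<theta>) ^ Suc i * \<bar>u - v\<bar> \<le> \<bar>F u' - F v'\<bar>" .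
  have 3: "\<bar>F z - F y'\<bar> \<le> (L * M) ^ Suc i * D" if "\<bar>z - y'\<bar> \<le> (L * M) ^ i * D" for z
  proof -
    have "\<bar>F z - F y'\<bar> \<le> L * M * \<bar>z - y'\<bar>" by (rule lipschitz)
    also have "\<dots> \<le> L * M * ((L * M) ^ i * D)" using that LM by (intro mult_left_mono) auto
    finally show ?thesis by (simp add: mult_ac)
  qed
  show ?case
    using 1 2 3[OF IH(3)] 3[OF IH(4)] by (simp add: u'_def v'_def y'_def)
qed

text \<open>
  A short interval meets the neighbourhood of at most one critical point, so its first or its last
  quarter keeps a distance comparable to its length. Over that quarter the distance to the
  nearest critical point \<open>x\<close> is comparable to its minimum \<open>r\<close>.
\<close>

lemma select_subinterval:
  assumes l: "0 < l" "l \<le> \<sigma> / 2"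
  obtains p' x r where "p \<le> p'" "p' + l / 4 \<le> p + l" "x \<in> C" "l / 4 \<le> r"
    "\<And>t. t \<in> {p'..p' + l / 4} \<Longrightarrow> r \<le> infdist t C"
    "\<And>t. t \<in> {p'..p' + l / 4} \<Longrightarrow> \<bar>t - x\<bar> \<le> 2 * r"
    "r \<in> (\<lambda>t. infdist t C) ` {p'..p' + l / 4}"
proof -
  \<comment> \<open>Were both outer quarters bad, there would be two critical points at distance less than \<open>3 * l / 2\<close>.\<close>
  have "\<exists>p'. p \<le> p' \<and> p' + l / 4 \<le> p + l \<and> (\<forall>t\<in>{p'..p' + l / 4}. l / 4 \<le> infdist t C)"
  proof (rule ccontr)
    assume none: "\<not> ?thesis"
    have ex: "\<exists>t s. t \<in> {p'..p' + l / 4} \<and> s \<in> C \<and> \<bar>t - s\<bar> < l / 4"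
      if p': "p \<le> p'" "p' + l / 4 \<le> p + l" for p'
    proof -
      obtain t where t: "t \<in> {p'..p' + l / 4}" "infdist t C < l / 4"
      proof -
        have "\<exists>t\<in>{p'..p' + l / 4}. \<not> l / 4 \<le> infdist t C" using none p' by blast
        then show ?thesis using that by (auto simp: not_le)
      qed
      obtain s where "s \<in> C" "infdist t C = dist t s"
        using infdist_attains_inf[OF closed_C C_nonempty] by blast
      with t show ?thesis by (auto simp: dist_real_def)
    qed
    obtain t1 s1 where 1: "t1 \<in> {p..p + l / 4}" "s1 \<in> C" "\<bar>t1 - s1\<bar> < l / 4"
      using ex[of p] l by auto
    obtain t2 s2 where 2: "t2 \<in> {p + 3 * l / 4..p + 3 * l / 4 + l / 4}" "s2 \<in> C" "\<bar>t2 - s2\<bar> < l / 4"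
      using ex[of "p + 3 * l / 4"] l by auto
    have "s1 < p + l / 2" "p - l / 4 < s1" "p + l / 2 < s2" "s2 < p + 5 * l / 4"
      using 1 2 l unfolding atLeastAtMost_iff by linarith+
    then have "s1 \<noteq> s2" "\<bar>s1 - s2\<bar> < 3 * l / 2" by linarith+
    with separated[OF \<open>s1 \<in> C\<close> \<open>s2 \<in> C\<close>] l pos show False by simp
  qed
  then obtain p' where p': "p \<le> p'" "p' + l / 4 \<le> p + l"
    and far: "\<And>t. t \<in> {p'..p' + l / 4} \<Longrightarrow> l / 4 \<le> infdist t C" by blast
  have "\<exists>t0\<in>{p'..p' + l / 4}. \<forall>t\<in>{p'..p' + l / 4}. infdist t0 C \<le> infdist t C"
    using l by (intro continuous_attains_inf continuous_intros) auto
  then obtain t0 where t0: "t0 \<in> {p'..p' + l / 4}"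
    "\<And>t. t \<in> {p'..p' + l / 4} \<Longrightarrow> infdist t0 C \<le> infdist t C" by blast
  obtain x where x: "x \<in> C" "infdist t0 C = dist t0 x"
    using infdist_attains_inf[OF closed_C C_nonempty] by blast
  have "\<bar>t - x\<bar> \<le> 2 * infdist t0 C" if "t \<in> {p'..p' + l / 4}" for t
  proof -
    have "\<bar>t - t0\<bar> \<le> l / 4" using that t0(1) unfolding atLeastAtMost_iff by linarith
    moreover have "l / 4 \<le> \<bar>t0 - x\<bar>" "infdist t0 C = \<bar>t0 - x\<bar>"
      using far[OF t0(1)] x(2) by (auto simp: dist_real_def)
    ultimately show ?thesis by linarith
  qed
  with that[OF p' x(1) far[OF t0(1)]] t0 show ?thesis by blast
qed

abbreviation \<rho> :: real where "\<rho> \<equiv> e ^ (k + 1)"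

text \<open>
  Lengths double, except for short intervals that may lie close to a critical point. The number
  \<open>i\<close> of steps spent along the critical orbit is the first one at which the deviation
  \<open>(L * M) ^ (i + 1) * r\<^sup>2\<close> is no longer small, or \<open>k\<close>. The gain must be 8 because
  passing to a quarter of the interval costs a factor 4.
\<close>

lemma return_expansion:
  assumes E: "\<And>t. t \<in> E \<Longrightarrow> F t \<in> E"
    and seg: "{p..p + l} \<subseteq> E" and l: "0 < l" "l \<le> \<sigma> / 2"
    and or: "\<rho> \<le> l \<or> (\<forall>t\<in>E. \<rho> \<le> infdist t C)"
  shows "\<exists>q. {q..q + 2 * l} \<subseteq> E"
proof -
  obtain p' x r where p': "p \<le> p'" "p' + l / 4 \<le> p + l" and x: "x \<in> C" and r: "l / 4 \<le> r"
    and far: "\<And>t. t \<in> {p'..p' + l / 4} \<Longrightarrow> r \<le> infdist t C"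
    and near: "\<And>t. t \<in> {p'..p' + l / 4} \<Longrightarrow> \<bar>t - x\<bar> \<le> 2 * r"
    and attained: "r \<in> (\<lambda>t. infdist t C) ` {p'..p' + l / 4}"
    using select_subinterval[OF l] by blast
  have r\<rho>: "\<rho> / 4 \<le> r"
  proof -
    obtain t0 where t0: "t0 \<in> {p'..p' + l / 4}" "r = infdist t0 C" using attained by blast
    have "t0 \<in> {p..p + l}" using t0(1) p' by simp
    then have "t0 \<in> E" using seg by blast
    with or t0(2) have "\<rho> \<le> l \<or> \<rho> \<le> r" by blast
    moreover have "0 < \<rho>" using pos by (intro zero_less_power)
    ultimately show ?thesis using r by linarith
  qed
  have r0: "0 < r" using r l by simp
  define u v where "u = p'" and "v = p' + l / 4"
  have uv: "closed_segment u v = {p'..p' + l / 4}" "\<bar>u - v\<bar> = l / 4"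
    using l by (auto simp: u_def v_def closed_segment_eq_real_ivl)
  define stop where "stop = (\<lambda>i. i = k \<or> c < 8 * (L * M) ^ (i + 1) * r\<^sup>2)"
  define i where "i = (LEAST i. stop i)"
  have "stop k" by (simp add: stop_def)
  then have i: "stop i" "i \<le> k" "\<And>j. j < i \<Longrightarrow> \<not> stop j"
    unfolding i_def using LeastI[of stop k] Least_le[of stop k] not_less_Least[of _ stop] by blast+
  have img: "closed_segment (F u) (F v) \<subseteq> F ` closed_segment u v"
    "L * \<kappa> * r * \<bar>u - v\<bar> \<le> \<bar>F u - F v\<bar>"
    using segment_image[of u v r] far uv(1) by auto
  have "closed_segment u v \<subseteq> {p..p + l}" unfolding uv(1) using p' by simp
  then have "F ` closed_segment u v \<subseteq> E" using seg E by blast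
  with img(1) have seg1: "closed_segment (F u) (F v) \<subseteq> E" by blast
  have near1: "\<bar>F t - F x\<bar> \<le> 4 * (L * M) * r\<^sup>2" if "t \<in> {u, v}" for t
  proof -
    have "\<bar>t - x\<bar> \<le> 2 * r" using that l by (intro near) (auto simp: u_def v_def)
    then have "\<bar>t - x\<bar>\<^sup>2 \<le> (2 * r)\<^sup>2" by (intro power_mono) auto
    then have "L * M * \<bar>t - x\<bar>\<^sup>2 \<le> L * M * (2 * r)\<^sup>2" using LM by (intro mult_left_mono) auto
    with quadratic[OF x, of t] show ?thesis by (simp add: power_mult_distrib)
  qed
  have "closed_segment ((F ^^ i) (F u)) ((F ^^ i) (F v)) \<subseteq> E \<and>
     (L * \<theta>) ^ i * \<bar>F u - F v\<bar> \<le> \<bar>(F ^^ i) (F u) - (F ^^ i) (F v)\<bar> \<and>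
     \<bar>(F ^^ i) (F u) - (F ^^ i) (F x)\<bar> \<le> (L * M) ^ i * (4 * (L * M) * r\<^sup>2) \<and>
     \<bar>(F ^^ i) (F v) - (F ^^ i) (F x)\<bar> \<le> (L * M) ^ i * (4 * (L * M) * r\<^sup>2)"
  proof (rule shadow_orbit[OF E _ _ _ _ seg1])
    fix j assume j: "j < i"
    have "c \<le> infdist ((F ^^ Suc j) x) C" using x j i(2) by (intro orbit) auto
    then show "c \<le> infdist ((F ^^ j) (F x)) C" by (simp add: funpow_swap1)
    show "(L * M) ^ j * (4 * (L * M) * r\<^sup>2) \<le> c / 2"
      using i(3)[OF j] by (simp add: stop_def mult_ac)
  next
    show "\<bar>F u - F x\<bar> \<le> 4 * (L * M) * r\<^sup>2" "\<bar>F v - F x\<bar> \<le> 4 * (L * M) * r\<^sup>2"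
      by (rule near1, simp)+
  qed
  then have fin: "closed_segment ((F ^^ i) (F u)) ((F ^^ i) (F v)) \<subseteq> E"
    "(L * \<theta>) ^ i * \<bar>F u - F v\<bar> \<le> \<bar>(F ^^ i) (F u) - (F ^^ i) (F v)\<bar>" by auto
  \<comment> \<open>Either all \<open>k\<close> steps are used and \<open>r \<ge> \<rho> / 4\<close> gives the gain \<open>(e * L * \<theta>) ^ (k + 1)\<close> up to a constant, or \<open>r\<close> is large by the choice of \<open>i\<close>.\<close>
  have gain: "8 \<le> (L * \<theta>) ^ (i + 1) * r"
    using i(1) unfolding stop_def
  proof
    assume "i = k"
    have "32 \<le> e * L * \<theta>" by (rule eL_large)
    also have "\<dots> \<le> (e * L * \<theta>) ^ (k + 1)"
      using eL_large by (intro self_le_power) auto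
    also have "\<dots> = (L * \<theta>) ^ (k + 1) * \<rho>"
      by (simp only: power_mult_distrib mult_ac)
    finally have "8 \<le> (L * \<theta>) ^ (k + 1) * (\<rho> / 4)" by simp
    also have "\<dots> \<le> (L * \<theta>) ^ (k + 1) * r"
      using r\<rho> pos by (intro mult_left_mono) auto
    finally show ?thesis using \<open>i = k\<close> by simp
  next
    assume *: "c < 8 * (L * M) ^ (i + 1) * r\<^sup>2"
    show ?thesis
      by (rule balanced_expansion_gain[of L \<theta> M c r "i + 1"]) (use * pos \<theta>_pos r0 L_large(1) in simp_all)
  qed
  have "2 * l \<le> (L * \<theta>) ^ (i + 1) * r * (l / 4)" using gain l by simp
  also have "\<dots> = (L * \<theta>) ^ i * (L * \<theta> * r * (l / 4))" by simp
  also have "\<dots> \<le> (L * \<theta>) ^ i * (L * \<kappa> * r * (l / 4))"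
    using \<theta>_le \<theta>_pos pos r0 l by (intro mult_left_mono mult_right_mono) auto
  also have "\<dots> \<le> (L * \<theta>) ^ i * \<bar>F u - F v\<bar>"
    using img(2) uv(2) pos by (intro mult_left_mono) auto
  finally have "2 * l \<le> \<bar>(F ^^ i) (F u) - (F ^^ i) (F v)\<bar>" using fin(2) by linarith
  with fin(1) show ?thesis by (rule interval_in_closed_segment)
qed

text \<open>
  A single point of \<open>E\<close> near the critical set suffices. Its image is so close to a critical value that
  the noise can be added there and the resulting interval still has \<open>k\<close> expanding steps ahead. The
  deviation stays small because \<open>L * M * e\<^sup>2 \<le> 1\<close>, so that \<open>(L * M) ^ n * e ^ (2 * n + 1) \<le> e\<close>.
\<close>

lemma noise_expansion:
  assumes E: "\<And>t w. t \<in> E \<Longrightarrow> \<bar>w\<bar> \<le> \<epsilon> \<Longrightarrow> F t + w \<in> E"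
    and \<epsilon>: "e ^ (2 * k + 1) \<le> \<epsilon>"
    and t: "t \<in> E" "infdist t C \<le> 2 * \<rho>"
  shows "\<exists>q. {q..q + \<rho>} \<subseteq> E"
proof -
  have e0: "0 < e" "e \<le> 1" using pos e_small by auto
  \<comment> \<open>Less noise than available keeps the interval inside the region where the orbit is followed.\<close>
  define \<epsilon>\<^sub>0 where "\<epsilon>\<^sub>0 = e ^ (2 * k + 1)"
  have \<epsilon>\<^sub>0: "0 < \<epsilon>\<^sub>0" using e0 by (simp add: \<epsilon>\<^sub>0_def)
  obtain x where x: "x \<in> C" "\<bar>t - x\<bar> \<le> 2 * \<rho>"
  proof -
    obtain x where "x \<in> C" "infdist t C = dist t x"
      using infdist_attains_inf[OF closed_C C_nonempty] by blast
    with t(2) that show ?thesis by (simp add: dist_real_def)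
  qed
  define D where "D = 4 * (L * M) * \<rho>\<^sup>2 + \<epsilon>\<^sub>0"
  have Fx: "\<bar>F t - F x\<bar> \<le> 4 * (L * M) * \<rho>\<^sup>2"
  proof -
    have "\<bar>t - x\<bar>\<^sup>2 \<le> (2 * \<rho>)\<^sup>2" using x by (intro power_mono) auto
    then have "L * M * \<bar>t - x\<bar>\<^sup>2 \<le> L * M * (2 * \<rho>)\<^sup>2" using LM by (intro mult_left_mono) auto
    with quadratic[OF x(1), of t] show ?thesis by (simp add: power_mult_distrib)
  qed
  define u v where "u = F t - \<epsilon>\<^sub>0" and "v = F t + \<epsilon>\<^sub>0"
  have seg: "closed_segment u v \<subseteq> E"
  proof
    fix z assume "z \<in> closed_segment u v"
    moreover have "closed_segment u v = {F t - \<epsilon>\<^sub>0..F t + \<epsilon>\<^sub>0}"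
      using \<epsilon>\<^sub>0 by (simp add: u_def v_def closed_segment_eq_real_ivl)
    ultimately have "\<bar>z - F t\<bar> \<le> \<epsilon>\<^sub>0" by (simp add: abs_le_iff)
    then have "\<bar>z - F t\<bar> \<le> \<epsilon>" using \<epsilon> unfolding \<epsilon>\<^sub>0_def by linarith
    from E[OF t(1) this] show "z \<in> E" by simp
  qed
  have "closed_segment ((F ^^ k) u) ((F ^^ k) v) \<subseteq> E \<and>
     (L * \<theta>) ^ k * \<bar>u - v\<bar> \<le> \<bar>(F ^^ k) u - (F ^^ k) v\<bar> \<and>
     \<bar>(F ^^ k) u - (F ^^ k) (F x)\<bar> \<le> (L * M) ^ k * D \<and>
     \<bar>(F ^^ k) v - (F ^^ k) (F x)\<bar> \<le> (L * M) ^ k * D"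
  proof (rule shadow_orbit[OF _ _ _ _ _ seg])
    fix s assume "s \<in> E"
    then show "F s \<in> E" using E[of s 0] \<epsilon> \<epsilon>\<^sub>0 by (simp add: \<epsilon>\<^sub>0_def)
  next
    fix j assume j: "j < k"
    have "c \<le> infdist ((F ^^ Suc j) x) C" using x j by (intro orbit) auto
    then show "c \<le> infdist ((F ^^ j) (F x)) C" by (simp add: funpow_swap1)
    have le: "(L * M) ^ n * e ^ (2 * n + 1) \<le> c / 16" for n
    proof -
      have "(L * M) ^ n * e ^ (2 * n + 1) = (L * M * e\<^sup>2) ^ n * e"
        by (simp only: power_mult_distrib power_mult power_add power_one_right mult.assoc)
      also have "\<dots> \<le> 1 * e"
      proof (rule mult_right_mono)
        have "0 \<le> L * M * e\<^sup>2" using LM by simp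
        then show "(L * M * e\<^sup>2) ^ n \<le> 1" using Le2_small by (rule power_le_one)
      qed (use e0 in simp)
      finally show ?thesis using e_small by simp
    qed
    have "(L * M) ^ j * (L * M) * e \<^sup>2 * e ^ (2 * k) \<le> (L * M) ^ j * (L * M) * e ^ (2 * (j + 1) + 1)"
    proof -
      have "2 * (j + 1) + 1 \<le> 2 + 2 * k" using j by simp
      then have "e ^ (2 + 2 * k) \<le> e ^ (2 * (j + 1) + 1)"
        using e0 by (intro power_decreasing) auto
      then have "e \<^sup>2 * e ^ (2 * k) \<le> e ^ (2 * (j + 1) + 1)"
        by (simp only: power_add[of e 2 "2 * k"])
      then have "(L * M) ^ j * (L * M) * (e \<^sup>2 * e ^ (2 * k)) \<le> (L * M) ^ j * (L * M) * e ^ (2 * (j + 1) + 1)"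
        using LM by (intro mult_left_mono) auto
      then show ?thesis by (simp only: mult.assoc)
    qed
    also have "\<dots> = (L * M) ^ (j + 1) * e ^ (2 * (j + 1) + 1)" by simp
    also have "\<dots> \<le> c / 16" by (rule le)
    finally have a: "(L * M) ^ j * (L * M) * e \<^sup>2 * e ^ (2 * k) \<le> c / 16" .
    have "e ^ (2 * k + 1) \<le> e ^ (2 * j + 1)"
      using j e0 by (intro power_decreasing) auto
    then have "(L * M) ^ j * e ^ (2 * k + 1) \<le> (L * M) ^ j * e ^ (2 * j + 1)"
      using LM by (intro mult_left_mono) auto
    with le[of j] have b: "(L * M) ^ j * \<epsilon>\<^sub>0 \<le> c / 16" by (simp add: \<epsilon>\<^sub>0_def)
    have "\<rho>\<^sup>2 = e\<^sup>2 * e ^ (2 * k)"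
      by (simp only: power_mult[symmetric] power_add[symmetric]) (simp add: mult.commute)
    then have "(L * M) ^ j * D = 4 * ((L * M) ^ j * (L * M) * e \<^sup>2 * e ^ (2 * k)) + (L * M) ^ j * \<epsilon>\<^sub>0"
      unfolding D_def by (simp only: distrib_left mult_ac)
    with a b pos show "(L * M) ^ j * D \<le> c / 2" by linarith
  next
    show "\<bar>u - F x\<bar> \<le> D" "\<bar>v - F x\<bar> \<le> D"
      using Fx \<epsilon>\<^sub>0 by (auto simp: u_def v_def D_def)
  qed
  then have fin: "closed_segment ((F ^^ k) u) ((F ^^ k) v) \<subseteq> E"
    "(L * \<theta>) ^ k * \<bar>u - v\<bar> \<le> \<bar>(F ^^ k) u - (F ^^ k) v\<bar>" by auto
  have "1 \<le> e * L * \<theta>" using eL_large by linarith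
  then have "1 \<le> (e * L * \<theta>) ^ k" by (rule one_le_power)
  then have "\<rho> * 1 \<le> \<rho> * (e * L * \<theta>) ^ k" by (rule mult_left_mono) (use e0 in simp)
  also have "\<dots> = (L * \<theta>) ^ k * \<epsilon>\<^sub>0"
  proof -
    have "\<epsilon>\<^sub>0 = \<rho> * e ^ k" by (simp add: \<epsilon>\<^sub>0_def power_add[symmetric] mult_2)
    then show ?thesis by (simp only: power_mult_distrib mult_ac)
  qed
  also have "\<dots> \<le> (L * \<theta>) ^ k * \<bar>u - v\<bar>"
  proof (rule mult_left_mono)
    show "\<epsilon>\<^sub>0 \<le> \<bar>u - v\<bar>" using \<epsilon>\<^sub>0 by (simp add: u_def v_def)
    show "0 \<le> (L * \<theta>) ^ k" using pos by simp
  qed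
  finally have "\<rho> \<le> \<bar>(F ^^ k) u - (F ^^ k) v\<bar>" using fin(2) by linarith
  with fin(1) show ?thesis by (rule interval_in_closed_segment)
qed

text \<open>
  If \<open>E\<close> approaches the critical set within \<open>2 * \<rho>\<close>, growth starts from length \<open>\<rho>\<close>; otherwise every
  interval in \<open>E\<close> can be doubled and growth starts from the noise. Both lead to length \<open>\<sigma> / 2\<close>, and one
  more expansion gives length 1.
\<close>

theorem unit_interval_reached:
  assumes A: "\<And>t w. t \<in> A \<Longrightarrow> \<bar>w\<bar> \<le> \<epsilon> \<Longrightarrow> F (t + w) \<in> A"
    and \<epsilon>: "e ^ (2 * k + 1) \<le> \<epsilon>" and "A \<noteq> {}"
  shows "\<exists>q. {q..q + 1} \<subseteq> A"
proof -
  define E where "E = {t + w | t w. t \<in> A \<and> \<bar>w\<bar> \<le> \<epsilon>}"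
  have FE: "F t \<in> A" if "t \<in> E" for t using that A by (auto simp: E_def)
  have E: "F t + w \<in> E" if "t \<in> E" "\<bar>w\<bar> \<le> \<epsilon>" for t w
    using FE[OF that(1)] that(2) by (auto simp: E_def)
  have e0: "0 < e" using pos by simp
  have \<epsilon>0: "0 < \<epsilon>" using \<epsilon> e0 by (meson less_le_trans zero_less_power)
  have E1: "F t \<in> E" if "t \<in> E" for t using E[OF that, of 0] \<epsilon>0 by simp
  define P where "P = (\<lambda>l. \<exists>p. {p..p + l} \<subseteq> E)"
  have down: "P x" if "P y" "x \<le> y" for x y
  proof -
    obtain p where "{p..p + y} \<subseteq> E" using \<open>P y\<close> by (auto simp: P_def)
    with \<open>x \<le> y\<close> have "{p..p + x} \<subseteq> E" by auto
    then show ?thesis by (auto simp: P_def)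
  qed
  have "\<exists>l. P l \<and> 0 < l \<and> l \<le> \<sigma> / 2 \<and> (\<forall>x. P x \<and> l \<le> x \<and> x < \<sigma> / 2 \<longrightarrow> P (2 * x))"
  proof (cases "\<exists>t\<in>E. infdist t C \<le> 2 * \<rho>")
    case True
    then have "P \<rho>" using noise_expansion[OF E \<epsilon>] by (auto simp: P_def)
    define l where "l = min \<rho> (\<sigma> / 2)"
    have l: "P l" "0 < l" "l \<le> \<sigma> / 2"
      using down[OF \<open>P \<rho>\<close>, of l] pos by (auto simp: l_def)
    have "P (2 * x)" if "P x" "l \<le> x" "x < \<sigma> / 2" for x
    proof -
      have "\<rho> \<le> x" using that by (auto simp: l_def min_def split: if_splits)
      moreover obtain p where "{p..p + x} \<subseteq> E" using \<open>P x\<close> by (auto simp: P_def)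
      ultimately show ?thesis
        using return_expansion[OF E1, of p x] that l by (auto simp: P_def)
    qed
    with l show ?thesis by blast
  next
    case False
    obtain a where "a \<in> A" using \<open>A \<noteq> {}\<close> by blast
    have "{a - \<epsilon>..a - \<epsilon> + \<epsilon>} \<subseteq> E"
    proof
      fix z assume "z \<in> {a - \<epsilon>..a - \<epsilon> + \<epsilon>}"
      then have "z = a + (z - a)" "\<bar>z - a\<bar> \<le> \<epsilon>" by auto
      with \<open>a \<in> A\<close> show "z \<in> E" unfolding E_def by blast
    qed
    then have "P \<epsilon>" unfolding P_def by (rule exI)
    define l where "l = min \<epsilon> (\<sigma> / 2)"
    have l: "P l" "0 < l" "l \<le> \<sigma> / 2"
      using down[OF \<open>P \<epsilon>\<close>, of l] pos \<epsilon>0 by (auto simp: l_def)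
    have far: "\<forall>t\<in>E. \<rho> \<le> infdist t C"
    proof
      fix t assume "t \<in> E"
      with False have "2 * \<rho> < infdist t C" by force
      moreover have "0 < \<rho>" using pos by simp
      ultimately show "\<rho> \<le> infdist t C" by linarith
    qed
    have "P (2 * x)" if "P x" "l \<le> x" "x < \<sigma> / 2" for x
    proof -
      obtain p where "{p..p + x} \<subseteq> E" using \<open>P x\<close> by (auto simp: P_def)
      with return_expansion[OF E1, of p x] far that l show ?thesis by (auto simp: P_def)
    qed
    with l show ?thesis by blast
  qed
  then obtain l where "P l \<and> 0 < l \<and> l \<le> \<sigma> / 2 \<and>
    (\<forall>x. P x \<and> l \<le> x \<and> x < \<sigma> / 2 \<longrightarrow> P (2 * x))" by (rule exE)
  then have l: "P l" "0 < l" "l \<le> \<sigma> / 2"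
    and double: "P x \<Longrightarrow> l \<le> x \<Longrightarrow> x < \<sigma> / 2 \<Longrightarrow> P (2 * x)" for x by simp_all
  have "P (\<sigma> / 2)" using l
  proof (rule doubling_reaches)
    fix x y assume "P y" "x \<le> y"
    then show "P x" by (rule down)
  qed (rule double)
  then obtain p where p: "{p..p + \<sigma> / 2} \<subseteq> E" unfolding P_def by (rule exE)
  have \<sigma>2: "0 < \<sigma> / 2" "\<sigma> / 2 \<le> \<sigma> / 2" using pos by auto
  obtain p' r where p': "p \<le> p'" "p' + \<sigma> / 2 / 4 \<le> p + \<sigma> / 2" and r: "\<sigma> / 2 / 4 \<le> r"
    and far: "\<And>t. t \<in> {p'..p' + \<sigma> / 2 / 4} \<Longrightarrow> r \<le> infdist t C"
    by (rule select_subinterval[OF \<sigma>2, of p]) rule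
  define v where "v = p' + \<sigma> / 8"
  have seg: "closed_segment p' v = {p'..p' + \<sigma> / 2 / 4}" "\<bar>p' - v\<bar> = \<sigma> / 8"
    using pos by (auto simp: v_def closed_segment_eq_real_ivl)
  have "\<sigma> / 8 \<le> infdist t C" if "t \<in> closed_segment p' v" for t
    using far[of t] that seg r by force
  note img = segment_image[of p' v "\<sigma> / 8", OF this]
  have "1 \<le> L * \<kappa> * (\<sigma> / 8) * \<bar>p' - v\<bar>"
    unfolding seg(2) using L_large(2) by (simp add: power2_eq_square)
  with img(2) have "1 \<le> \<bar>F p' - F v\<bar>" by linarith
  moreover have "closed_segment (F p') (F v) \<subseteq> A"
  proof -
    have "closed_segment p' v \<subseteq> E" using seg p p' by auto
    with FE img(1) show ?thesis by blast
  qed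
  ultimately show ?thesis by (intro interval_in_closed_segment)
qed

end

section \<open>Nondegenerate functions on the circle\<close>

lemma finite_separated:
  fixes S :: "'a::metric_space set"
  assumes "finite S"
  obtains \<sigma> where "0 < \<sigma>" "\<And>x y. x \<in> S \<Longrightarrow> y \<in> S \<Longrightarrow> x \<noteq> y \<Longrightarrow> \<sigma> \<le> dist x y"
proof -
  define D where "D = (\<lambda>(x, y). dist x y) ` {(x, y) \<in> S \<times> S. x \<noteq> y}"
  have "finite D" using assms by (auto simp: D_def intro: finite_subset[of _ "S \<times> S"])
  then have "0 < Min (insert 1 D)" by (auto simp: D_def)
  moreover have "Min (insert 1 D) \<le> dist x y" if "x \<in> S" "y \<in> S" "x \<noteq> y" for x y
    using \<open>finite D\<close> that by (intro Min_le) (auto simp: D_def)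
  ultimately show ?thesis by (rule that)
qed

lemma bounded_periodic_lift:
  fixes \<phi> :: "circle \<Rightarrow> real"
  assumes "continuous_on UNIV (\<lambda>t. \<phi> (circle_of t))"
  obtains B where "\<And>x. \<bar>\<phi> x\<bar> \<le> B"
proof -
  have "compact ((\<lambda>t. \<phi> (circle_of t)) ` {0..1})"
    using assms by (intro compact_continuous_image compact_Icc) (rule continuous_on_subset, auto)
  then obtain B where B: "\<And>t. t \<in> {0..1} \<Longrightarrow> \<bar>\<phi> (circle_of t)\<bar> \<le> B"
    using compact_imp_bounded bounded_iff by (metis image_eqI real_norm_def)
  have "\<bar>\<phi> x\<bar> \<le> B" for x
    using B[of "coord x"] coord_bounds[of x] by (simp add: circle_of_coord)
  then show ?thesis by (rule that)
qed

definition critical_lift :: "(circle \<Rightarrow> real) \<Rightarrow> real set" where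
  "critical_lift \<psi> = {t. circle_of t \<in> critical_set \<psi>}"

lemma infdist_critical_lift_le:
  assumes "s \<in> critical_lift \<psi>"
  shows "infdist (circle_of t) (critical_set \<psi>) \<le> \<bar>t - s\<bar>"
  using infdist_le[of "circle_of s" "critical_set \<psi>" "circle_of t"] assms dist_circle_of_le[of t s]
  by (simp add: critical_lift_def)

text \<open>
  A sequence violating the bound with constants tending to 0 would accumulate at a critical point
  \<open>l\<close>, and its difference quotients there would force the second derivative at \<open>l\<close> to vanish.
\<close>

lemma nondegenerate_lower_bound:
  fixes \<psi> :: "circle \<Rightarrow> real"
  defines "g' \<equiv> \<lambda>t. circle_deriv \<psi> (circle_of t)"
    and "g'' \<equiv> \<lambda>t. circle_deriv (circle_deriv \<psi>) (circle_of t)"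
  assumes dg': "\<And>t. (g' has_real_derivative g'' t) (at t)"
    and nondeg: "\<And>t. t \<in> critical_lift \<psi> \<Longrightarrow> g'' t \<noteq> 0"
    and closed: "closed (critical_lift \<psi>)" and nonempty: "critical_lift \<psi> \<noteq> {}"
  obtains \<kappa> where "0 < \<kappa>" "\<And>t. \<kappa> * infdist t (critical_lift \<psi>) \<le> \<bar>g' t\<bar>"
proof -
  let ?C = "critical_lift \<psi>"
  have "\<exists>\<kappa>>0. \<forall>t\<in>{0..1}. \<kappa> * infdist t ?C \<le> \<bar>g' t\<bar>"
  proof (rule ccontr)
    assume none: "\<not> ?thesis"
    have "\<exists>t\<in>{0..1}. \<bar>g' t\<bar> < inverse (real (Suc n)) * infdist t ?C" for n
      using none by (auto simp: not_le)
    then obtain s where s: "\<And>n. s n \<in> {0..1}"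
      "\<And>n. \<bar>g' (s n)\<bar> < inverse (real (Suc n)) * infdist (s n) ?C" by metis
    obtain l r where l: "l \<in> {0..1}" "strict_mono r" "(s \<circ> r) \<longlonglongrightarrow> l"
      using s(1) compact_Icc[of 0 "1::real"] unfolding compact_def by metis
    define z where "z = s \<circ> r"
    define \<eta> where "\<eta> = (\<lambda>n. inverse (real (Suc (r n))))"
    have zl: "z \<longlonglongrightarrow> l" using l(3) by (simp add: z_def)
    have \<eta>0: "\<eta> \<longlonglongrightarrow> 0"
      using LIMSEQ_subseq_LIMSEQ[OF LIMSEQ_inverse_real_of_nat \<open>strict_mono r\<close>]
      by (simp add: \<eta>_def o_def)
    have z: "\<bar>g' (z n)\<bar> < \<eta> n * infdist (z n) ?C" for n
      using s(2) by (simp add: z_def \<eta>_def)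
    have "(\<lambda>n. \<eta> n * infdist (z n) ?C) \<longlonglongrightarrow> 0 * infdist l ?C"
      using \<eta>0 zl by (intro tendsto_intros)
    then have "(\<lambda>n. \<eta> n * infdist (z n) ?C) \<longlonglongrightarrow> 0" by simp
    then have "(\<lambda>n. g' (z n)) \<longlonglongrightarrow> 0"
      by (rule Lim_null_comparison[rotated]) (use z in \<open>auto intro: always_eventually less_imp_le\<close>)
    moreover have "(\<lambda>n. g' (z n)) \<longlonglongrightarrow> g' l"
      using isCont_tendsto_compose[OF DERIV_isCont[OF dg'] zl] .
    ultimately have "g' l = 0" using LIMSEQ_unique by blast
    then have lC: "l \<in> ?C" by (simp add: critical_lift_def critical_set_def g'_def)
    have "z n \<noteq> l" for n using z[of n] lC by auto
    then have "filterlim z (at l) sequentially"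
      using zl by (simp add: filterlim_at)
    moreover have "((\<lambda>t. (g' t - g' l) / (t - l)) \<longlongrightarrow> g'' l) (at l)"
      using dg'[of l] by (simp add: has_field_derivative_iff)
    ultimately have lim: "(\<lambda>n. (g' (z n) - g' l) / (z n - l)) \<longlonglongrightarrow> g'' l"
      by (rule filterlim_compose[rotated])
    have "(\<lambda>n. (g' (z n) - g' l) / (z n - l)) \<longlonglongrightarrow> 0"
    proof (rule Lim_null_comparison[OF always_eventually \<eta>0], rule allI)
      fix n
      have "infdist (z n) ?C \<le> \<bar>z n - l\<bar>" using infdist_le[OF lC] by (simp add: dist_real_def)
      then have "\<eta> n * infdist (z n) ?C \<le> \<eta> n * \<bar>z n - l\<bar>"
        by (intro mult_left_mono) (auto simp: \<eta>_def)
      with z[of n] have "\<bar>g' (z n)\<bar> \<le> \<eta> n * \<bar>z n - l\<bar>" by linarith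
      then show "norm ((g' (z n) - g' l) / (z n - l)) \<le> \<eta> n"
        using \<open>g' l = 0\<close> \<open>z n \<noteq> l\<close> by (simp add: field_simps)
    qed
    with lim have "g'' l = 0" using LIMSEQ_unique by blast
    with nondeg[OF lC] show False by simp
  qed
  then obtain \<kappa> where \<kappa>: "0 < \<kappa>" "\<And>t. t \<in> {0..1} \<Longrightarrow> \<kappa> * infdist t ?C \<le> \<bar>g' t\<bar>" by blast
  have "\<kappa> * infdist t ?C \<le> \<bar>g' t\<bar>" for t
  proof -
    obtain s where s: "s \<in> ?C" "infdist (frac t) ?C = dist (frac t) s"
      using infdist_attains_inf[OF closed nonempty] by blast
    have "s + of_int \<lfloor>t\<rfloor> \<in> ?C" using s(1) by (simp add: critical_lift_def)
    then have "infdist t ?C \<le> dist t (s + of_int \<lfloor>t\<rfloor>)" by (rule infdist_le)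
    also have "\<dots> = infdist (frac t) ?C" using s(2) by (simp add: dist_real_def frac_def algebra_simps)
    finally have "\<kappa> * infdist t ?C \<le> \<kappa> * infdist (frac t) ?C"
      using \<kappa>(1) by (intro mult_left_mono) auto
    also have "\<dots> \<le> \<bar>g' (frac t)\<bar>"
      using frac_lt_1[of t] by (intro \<kappa>(2)) (simp add: less_imp_le)
    also have "g' (frac t) = g' t"
      using circle_of_add_int[of t "- \<lfloor>t\<rfloor>"] by (simp add: g'_def frac_def)
    finally show ?thesis .
  qed
  with \<kappa>(1) show ?thesis by (rule that)
qed

text \<open>
  The constants that make the lift of \<open>L * \<psi> + a\<close> satisfy the assumptions of \<open>expanding_lift\<close>,
  independently of \<open>L\<close> and \<open>a\<close>. A critical point exists because the lift takes equal values at
  0 and 1; distinct lifts of one critical point are at distance at least 1.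
\<close>

lemma nondegenerate_lift_constants:
  fixes \<psi> :: "circle \<Rightarrow> real"
  assumes C2: "circle_C2 \<psi>" and fin: "finite (critical_set \<psi>)"
    and nondeg: "\<And>x. x \<in> critical_set \<psi> \<Longrightarrow> circle_deriv (circle_deriv \<psi>) x \<noteq> 0"
  defines "C \<equiv> critical_lift \<psi>"
  obtains \<kappa> M \<sigma> where "0 < \<kappa>" "1 \<le> M" "0 < \<sigma>"
    "\<And>t. \<kappa> * infdist t C \<le> \<bar>circle_deriv \<psi> (circle_of t)\<bar>"
    "\<And>s t. \<bar>\<psi> (circle_of s) - \<psi> (circle_of t)\<bar> \<le> M * \<bar>s - t\<bar>"
    "\<And>s t. s \<in> C \<Longrightarrow> \<bar>\<psi> (circle_of t) - \<psi> (circle_of s)\<bar> \<le> M * \<bar>t - s\<bar>\<^sup>2"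
    "closed C" "C \<noteq> {}"
    "\<And>s t. s \<in> C \<Longrightarrow> t \<in> C \<Longrightarrow> s \<noteq> t \<Longrightarrow> \<sigma> \<le> \<bar>s - t\<bar>"
proof -
  define g g' g'' where "g = (\<lambda>t. \<psi> (circle_of t))" and "g' = (\<lambda>t. circle_deriv \<psi> (circle_of t))"
    and "g'' = (\<lambda>t. circle_deriv (circle_deriv \<psi>) (circle_of t))"
  have dg: "(g has_real_derivative g' t) (at t)" for t
    unfolding g_def g'_def using C2 by (intro deriv_circle_lift) (simp add: circle_C2_def)
  have dg': "(g' has_real_derivative g'' t) (at t)" for t
    unfolding g'_def g''_def using C2 by (intro deriv_circle_lift) (simp add: circle_C2_def)
  have cont_g': "continuous_on UNIV g'"
    using dg' by (meson DERIV_isCont continuous_at_imp_continuous_on)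
  have cont_g'': "continuous_on UNIV g''"
  proof -
    have "continuous_on UNIV (circle_deriv (circle_deriv \<psi>))" using C2 by (simp add: circle_C2_def)
    then show ?thesis
      unfolding g''_def by (rule continuous_on_compose2[OF _ continuous_on_circle_of]) simp
  qed
  have C_eq: "C = {t. g' t = 0}"
    by (simp add: C_def critical_lift_def critical_set_def g'_def)
  have closed: "closed C"
  proof -
    have "C = g' -` {0}" by (auto simp: C_eq)
    then show ?thesis using cont_g' by (simp add: continuous_on_closed_vimage)
  qed
  have nonempty: "C \<noteq> {}"
  proof -
    have "g 0 = g 1" using circle_of_add_int[of 0 1] by (simp add: g_def)
    moreover have "continuous_on {0..1} g"
      using dg by (meson DERIV_isCont continuous_at_imp_continuous_on)
    ultimately obtain z where "(g has_real_derivative 0) (at z)"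
      using Rolle[of 0 1 g] dg real_differentiable_def by fastforce
    then have "g' z = 0" using DERIV_unique[OF dg] by blast
    then show ?thesis by (auto simp: C_eq)
  qed
  obtain \<kappa> where \<kappa>: "0 < \<kappa>" "\<And>t. \<kappa> * infdist t C \<le> \<bar>g' t\<bar>"
  proof (rule nondegenerate_lower_bound[of \<psi>])
    show "((\<lambda>t. circle_deriv \<psi> (circle_of t)) has_real_derivative
        circle_deriv (circle_deriv \<psi>) (circle_of t)) (at t)" for t
      using dg' by (simp add: g'_def g''_def)
    show "circle_deriv (circle_deriv \<psi>) (circle_of t) \<noteq> 0" if "t \<in> critical_lift \<psi>" for t
      using that nondeg by (simp add: critical_lift_def)
  qed (use closed nonempty in \<open>auto simp: C_def g'_def\<close>)
  obtain B1 where B1: "\<And>x. \<bar>circle_deriv \<psi> x\<bar> \<le> B1"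
    using bounded_periodic_lift cont_g' unfolding g'_def by blast
  obtain B2 where B2: "\<And>x. \<bar>circle_deriv (circle_deriv \<psi>) x\<bar> \<le> B2"
    using bounded_periodic_lift cont_g'' unfolding g''_def by blast
  define M where "M = max 1 (max B1 B2)"
  have M: "1 \<le> M" "\<bar>g' t\<bar> \<le> M" "\<bar>g'' t\<bar> \<le> M" for t
    using B1[of "circle_of t"] B2[of "circle_of t"] by (auto simp: M_def g'_def g''_def)
  have lip: "\<bar>g s - g t\<bar> \<le> M * \<bar>s - t\<bar>" for s t
    using field_differentiable_bound[of UNIV g g' M s t] dg M by auto
  have lip': "\<bar>g' s - g' t\<bar> \<le> M * \<bar>s - t\<bar>" for s t
    using field_differentiable_bound[of UNIV g' g'' M s t] dg' M by auto
  have quad: "\<bar>g t - g s\<bar> \<le> M * \<bar>t - s\<bar>\<^sup>2" if "s \<in> C" for s t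
  proof -
    have "\<bar>g' z\<bar> \<le> M * \<bar>t - s\<bar>" if "z \<in> closed_segment s t" for z
    proof -
      have "\<bar>z - s\<bar> \<le> \<bar>t - s\<bar>" using that by (auto simp: closed_segment_eq_real_ivl split: if_splits)
      then have "M * \<bar>z - s\<bar> \<le> M * \<bar>t - s\<bar>" using M(1) by (intro mult_left_mono) auto
      with lip'[of z s] \<open>s \<in> C\<close> show ?thesis by (simp add: C_eq)
    qed
    moreover have "(g has_field_derivative g' z) (at z within closed_segment s t)" for z
      using dg by (rule has_field_derivative_at_within)
    ultimately have "norm (g t - g s) \<le> M * \<bar>t - s\<bar> * norm (t - s)"
      by (intro field_differentiable_bound[of "closed_segment s t" g g']) auto
    then show ?thesis by (simp add: power2_eq_square)
  qed
  obtain \<sigma> where \<sigma>: "0 < \<sigma>"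
    "\<And>x y. x \<in> critical_set \<psi> \<Longrightarrow> y \<in> critical_set \<psi> \<Longrightarrow> x \<noteq> y \<Longrightarrow> \<sigma> \<le> dist x y"
    using finite_separated[OF fin] by blast
  have sep: "min \<sigma> 1 \<le> \<bar>s - t\<bar>" if "s \<in> C" "t \<in> C" "s \<noteq> t" for s t
  proof (cases "circle_of s = circle_of t")
    case True
    then obtain n :: int where "s = t + of_int n" by (auto simp: circle_of_eq_iff)
    moreover from this \<open>s \<noteq> t\<close> have "1 \<le> \<bar>n\<bar>" by (cases "n = 0") auto
    ultimately have "1 \<le> \<bar>s - t\<bar>" by simp
    then show ?thesis by simp
  next
    case False
    then have "\<sigma> \<le> dist (circle_of s) (circle_of t)"
      using that by (intro \<sigma>(2)) (auto simp: C_def critical_lift_def)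
    with dist_circle_of_le[of s t] show ?thesis by simp
  qed
  show ?thesis
    using that[of \<kappa> M "min \<sigma> 1"] \<kappa> M(1) \<sigma>(1) lip quad closed nonempty sep
    by (simp add: g_def g'_def)
qed

section \<open>Minimality of the noisy circle map\<close>

lemma large_parameter:
  fixes \<beta> c \<kappa> M \<sigma> :: real
  assumes "0 < \<beta>" "\<beta> \<le> 1/4" "0 < c" "0 < \<kappa>" "1 \<le> M" "0 < \<sigma>"
  obtains L0 where "1 \<le> L0"
    "\<And>L e. L0 \<le> L \<Longrightarrow> e = L powr (\<beta> - 1) \<Longrightarrow>
       16 * e \<le> c \<and> 32 \<le> e * L * (\<kappa> * c / 2) \<and> L * M * e\<^sup>2 \<le> 1 \<and>
       512 * M \<le> c * L * (\<kappa> * c / 2)\<^sup>2 \<and> 64 \<le> L * \<kappa> * \<sigma>\<^sup>2"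
proof -
  define \<theta> where "\<theta> = \<kappa> * c / 2"
  have \<theta>: "0 < \<theta>" using assms by (simp add: \<theta>_def)
  have small: "\<forall>\<^sub>F L in at_top. L powr s < \<delta>" if "s < 0" "0 < \<delta>" for s \<delta> :: real
    using order_tendstoD(2)[OF tendsto_neg_powr[OF \<open>s < 0\<close> filterlim_ident] \<open>0 < \<delta>\<close>] .
  have "\<forall>\<^sub>F L in at_top. 1 \<le> L \<and> L powr (\<beta> - 1) < c / 16 \<and> L powr (- \<beta>) < \<theta> / 32 \<and>
      L powr (2 * \<beta> - 1) < 1 / M \<and> 512 * M / (c * \<theta>\<^sup>2) \<le> L \<and> 64 / (\<kappa> * \<sigma>\<^sup>2) \<le> L"
    using assms \<theta> by (intro eventually_conj small eventually_ge_at_top) auto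
  then obtain L0 where L0: "\<And>L. L0 \<le> L \<Longrightarrow> 1 \<le> L \<and> L powr (\<beta> - 1) < c / 16 \<and> L powr (- \<beta>) < \<theta> / 32 \<and>
      L powr (2 * \<beta> - 1) < 1 / M \<and> 512 * M / (c * \<theta>\<^sup>2) \<le> L \<and> 64 / (\<kappa> * \<sigma>\<^sup>2) \<le> L"
    unfolding eventually_at_top_linorder by blast
  show ?thesis
  proof (rule that[of "max 1 L0"])
    fix L e :: real assume "max 1 L0 \<le> L" and e: "e = L powr (\<beta> - 1)"
    then have L: "1 \<le> L" "L powr (\<beta> - 1) < c / 16" "L powr (- \<beta>) < \<theta> / 32"
      "L powr (2 * \<beta> - 1) < 1 / M" "512 * M / (c * \<theta>\<^sup>2) \<le> L" "64 / (\<kappa> * \<sigma>\<^sup>2) \<le> L"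
      using L0[of L] by auto
    have "L powr (\<beta> - 1) * L powr 1 = L powr \<beta>" by (subst powr_add[symmetric]) simp
    then have "e * L = L powr \<beta>" using L(1) by (simp add: e)
    moreover have "L powr \<beta> * L powr (- \<beta>) = 1" using L(1) by (simp add: powr_add[symmetric])
    ultimately have "1 = e * L * L powr (- \<beta>)" by simp
    also have "\<dots> \<le> e * L * (\<theta> / 32)" using L e by (intro mult_left_mono) auto
    finally have 2: "32 \<le> e * L * \<theta>" by simp
    have "L * e\<^sup>2 = L powr 1 * (L powr (\<beta> - 1) * L powr (\<beta> - 1))"
      using L(1) by (simp add: e power2_eq_square)
    also have "\<dots> = L powr (2 * \<beta> - 1)"
      by (simp only: powr_add[symmetric]) (simp add: algebra_simps)
    finally have "L * e\<^sup>2 = L powr (2 * \<beta> - 1)" .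
    then have "L * e\<^sup>2 \<le> 1 / M" using L(4) by simp
    then have "M * (L * e\<^sup>2) \<le> M * (1 / M)" using assms by (intro mult_left_mono) auto
    then have 3: "L * M * e\<^sup>2 \<le> 1" using assms by (simp add: mult_ac)
    have 4: "512 * M \<le> c * L * \<theta>\<^sup>2" using L(5) assms \<theta> by (simp add: field_simps)
    have 5: "64 \<le> L * \<kappa> * \<sigma>\<^sup>2" using L(6) assms by (simp add: field_simps)
    from L(2) have 1: "16 * e \<le> c" by (simp add: e)
    from 1 2 3 4 5 show "16 * e \<le> c \<and> 32 \<le> e * L * (\<kappa> * c / 2) \<and> L * M * e\<^sup>2 \<le> 1 \<and>
       512 * M \<le> c * L * (\<kappa> * c / 2)\<^sup>2 \<and> 64 \<le> L * \<kappa> * \<sigma>\<^sup>2"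
      unfolding \<theta>_def by blast
  qed simp
qed

text \<open>
  Decreasing \<open>\<beta>\<close> strengthens the claim, so \<open>\<beta>\<close> may be replaced by its minimum with \<open>1 / 4\<close>, as
  the bound on \<open>L * M * e\<^sup>2\<close> requires.
\<close>

theorem noisy_map_minimal:
  fixes \<psi> :: "circle \<Rightarrow> real" and \<beta> c :: real
  assumes C2: "circle_C2 \<psi>" and fin: "finite (critical_set \<psi>)"
    and nondeg: "\<And>x. x \<in> critical_set \<psi> \<Longrightarrow> circle_deriv (circle_deriv \<psi>) x \<noteq> 0"
    and \<beta>: "0 < \<beta>" and c: "0 < c" "c < 1"
  obtains L0 where "1 \<le> L0"
    "\<And>L a k \<epsilon> A. L0 \<le> L \<Longrightarrow>
      (\<And>x l. x \<in> critical_set \<psi> \<Longrightarrow> 1 \<le> l \<Longrightarrow> l \<le> k \<Longrightarrow>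
        c \<le> infdist ((circle_map \<psi> L a ^^ l) x) (critical_set \<psi>)) \<Longrightarrow>
      L powr (- (real (2 * k + 1) * (1 - \<beta>))) \<le> \<epsilon> \<Longrightarrow>
      A \<noteq> {} \<Longrightarrow>
      (\<And>x w. x \<in> A \<Longrightarrow> \<bar>w\<bar> \<le> \<epsilon> \<Longrightarrow> perturbed (circle_map \<psi> L a) w x \<in> A) \<Longrightarrow>
      A = UNIV"
proof -
  define C where "C = critical_lift \<psi>"
  define g where "g = (\<lambda>t. \<psi> (circle_of t))"
  define g' where "g' = (\<lambda>t. circle_deriv \<psi> (circle_of t))"
  obtain \<kappa> M \<sigma> where pos: "0 < \<kappa>" "1 \<le> M" "0 < \<sigma>"
    and low: "\<And>t. \<kappa> * infdist t C \<le> \<bar>g' t\<bar>"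
    and lip: "\<And>s t. \<bar>g s - g t\<bar> \<le> M * \<bar>s - t\<bar>"
    and quad: "\<And>s t. s \<in> C \<Longrightarrow> \<bar>g t - g s\<bar> \<le> M * \<bar>t - s\<bar>\<^sup>2"
    and C: "closed C" "C \<noteq> {}"
    and sep: "\<And>s t. s \<in> C \<Longrightarrow> t \<in> C \<Longrightarrow> s \<noteq> t \<Longrightarrow> \<sigma> \<le> \<bar>s - t\<bar>"
    unfolding C_def g_def g'_def
    by (rule nondegenerate_lift_constants[OF C2 fin nondeg]) blast+
  define b where "b = min \<beta> (1/4)"
  have b: "0 < b" "b \<le> 1/4" using \<beta> by (auto simp: b_def)
  obtain L0 where L0: "1 \<le> L0"
    "\<And>L e. L0 \<le> L \<Longrightarrow> e = L powr (b - 1) \<Longrightarrow>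
       16 * e \<le> c \<and> 32 \<le> e * L * (\<kappa> * c / 2) \<and> L * M * e\<^sup>2 \<le> 1 \<and>
       512 * M \<le> c * L * (\<kappa> * c / 2)\<^sup>2 \<and> 64 \<le> L * \<kappa> * \<sigma>\<^sup>2"
    using large_parameter[OF b c(1) pos] by blast
  show ?thesis
  proof (rule that[OF L0(1)])
    fix L a \<epsilon> :: real and k :: nat and A :: "circle set"
    assume "L0 \<le> L"
      and orb: "\<And>x l. x \<in> critical_set \<psi> \<Longrightarrow> 1 \<le> l \<Longrightarrow> l \<le> k \<Longrightarrow>
        c \<le> infdist ((circle_map \<psi> L a ^^ l) x) (critical_set \<psi>)"
      and \<epsilon>: "L powr (- (real (2 * k + 1) * (1 - \<beta>))) \<le> \<epsilon>"
      and "A \<noteq> {}"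
      and inv: "\<And>x w. x \<in> A \<Longrightarrow> \<bar>w\<bar> \<le> \<epsilon> \<Longrightarrow> perturbed (circle_map \<psi> L a) w x \<in> A"
    define e where "e = L powr (b - 1)"
    have L1: "1 \<le> L" using L0(1) \<open>L0 \<le> L\<close> by simp
    then have Lpos: "0 < L" by simp
    define F where "F = (\<lambda>t. L * g t + a)"
    have lift: "circle_of (F t) = circle_map \<psi> L a (circle_of t)" for t
      by (simp add: F_def g_def circle_map_def)
    have lift_pow: "circle_of ((F ^^ l) t) = (circle_map \<psi> L a ^^ l) (circle_of t)" for l t
      by (induction l) (simp_all add: lift)
    interpret expanding_lift F "\<lambda>t. L * g' t" C L \<kappa> M c \<sigma> e k
    proof
      show "(F has_real_derivative L * g' t) (at t)" for t
        unfolding F_def g_def g'_def using C2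
        by (auto intro!: derivative_eq_intros deriv_circle_lift simp: circle_C2_def)
      show "L * \<kappa> * infdist t C \<le> \<bar>L * g' t\<bar>" for t
        using low[of t] Lpos by (simp add: abs_mult)
      show "\<bar>F s - F t\<bar> \<le> L * M * \<bar>s - t\<bar>" for s t
      proof -
        have "\<bar>F s - F t\<bar> = L * \<bar>g s - g t\<bar>"
          using Lpos by (simp add: F_def abs_mult flip: right_diff_distrib)
        with lip[of s t] Lpos show ?thesis by simp
      qed
      show "\<bar>F t - F s\<bar> \<le> L * M * \<bar>t - s\<bar>\<^sup>2" if "s \<in> C" for s t
      proof -
        have "\<bar>F t - F s\<bar> = L * \<bar>g t - g s\<bar>"
          using Lpos by (simp add: F_def abs_mult flip: right_diff_distrib)
        also have "\<dots> \<le> L * (M * \<bar>t - s\<bar>\<^sup>2)" using quad[OF that, of t] Lpos by (intro mult_left_mono) auto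
        finally show ?thesis by (simp only: mult.assoc)
      qed
      show "c \<le> infdist ((F ^^ l) s) C" if "s \<in> C" "1 \<le> l" "l \<le> k" for s l
      proof -
        obtain t where t: "t \<in> C" "infdist ((F ^^ l) s) C = dist ((F ^^ l) s) t"
          using infdist_attains_inf[OF C] by blast
        have "c \<le> infdist ((circle_map \<psi> L a ^^ l) (circle_of s)) (critical_set \<psi>)"
          using that by (intro orb) (auto simp: C_def critical_lift_def)
        also have "\<dots> \<le> \<bar>(F ^^ l) s - t\<bar>"
          using t(1) infdist_critical_lift_le[of t \<psi> "(F ^^ l) s"] by (simp add: C_def lift_pow)
        finally show ?thesis using t(2) by (simp add: dist_real_def)
      qed
      have "1 * 1 \<le> L * M" using L1 pos by (intro mult_mono) auto
      then show "1 \<le> L * M" by simp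
      show "0 < e" using Lpos by (simp add: e_def)
    qed (use C sep pos c Lpos L0(2)[OF \<open>L0 \<le> L\<close> e_def] in auto)
    have "e ^ (2 * k + 1) = L powr (- (real (2 * k + 1) * (1 - b)))"
    proof -
      have "e ^ (2 * k + 1) = e powr (real (2 * k + 1))"
        using Lpos by (intro powr_realpow[symmetric]) (simp add: e_def)
      also have "\<dots> = L powr ((b - 1) * real (2 * k + 1))" by (simp only: e_def powr_powr)
      also have "(b - 1) * real (2 * k + 1) = - (real (2 * k + 1) * (1 - b))"
        by (simp add: algebra_simps)
      finally show ?thesis .
    qed
    also have "\<dots> \<le> L powr (- (real (2 * k + 1) * (1 - \<beta>)))"
      using L1 by (intro powr_mono) (auto simp: b_def intro!: mult_left_mono)
    finally have \<epsilon>': "e ^ (2 * k + 1) \<le> \<epsilon>" using \<epsilon> by linarith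
    have "\<exists>q. {q..q + 1} \<subseteq> {t. circle_of t \<in> A}"
    proof (rule unit_interval_reached[OF _ \<epsilon>'])
      fix t w assume "t \<in> {t. circle_of t \<in> A}" "\<bar>w\<bar> \<le> \<epsilon>"
      then have "perturbed (circle_map \<psi> L a) w (circle_of t) \<in> A" by (intro inv) auto
      then show "F (t + w) \<in> {t. circle_of t \<in> A}" by (simp add: perturbed_def lift)
    next
      obtain x where "x \<in> A" using \<open>A \<noteq> {}\<close> by blast
      then have "coord x \<in> {t. circle_of t \<in> A}" by (simp add: circle_of_coord)
      then show "{t. circle_of t \<in> A} \<noteq> {}" by blast
    qed
    then obtain q where "{q..q + 1} \<subseteq> {t. circle_of t \<in> A}" ..
    then have "circle_of ` {q..q + 1} \<subseteq> A" by blast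
    moreover have "circle_of ` {q..q + 1} = UNIV" by (intro circle_of_Icc_eq_UNIV) simp
    ultimately show "A = UNIV" by auto
  qed
qed

section \<open>Stationary measures of regenerative kernels\<close>

definition stationary_for :: "('a \<Rightarrow> 'a measure) \<Rightarrow> 'a measure \<Rightarrow> 'a measure \<Rightarrow> bool" where
  "stationary_for K M \<mu> \<longleftrightarrow> prob_space \<mu> \<and> sets \<mu> = sets M \<and>
     (\<forall>B\<in>sets M. emeasure \<mu> B = (\<integral>\<^sup>+ x. emeasure (K x) B \<partial>\<mu>))"

text \<open>
  Countable sums of measures are expressed as \<open>count_space UNIV \<bind> T\<close>, which makes the
  integration rules of the Giry monad available; here the index set has two elements.
\<close>

lemma nn_integral_add_measure:
  assumes sets: "sets A = sets M" "sets B = sets M" "sets D = sets M"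
    and sub: "subprob_space A" "subprob_space B"
    and sum: "\<And>X. X \<in> sets M \<Longrightarrow> emeasure D X = emeasure A X + emeasure B X"
    and g: "g \<in> borel_measurable M"
  shows "(\<integral>\<^sup>+x. g x \<partial>D) = (\<integral>\<^sup>+x. g x \<partial>A) + (\<integral>\<^sup>+x. g x \<partial>B)"
proof -
  define T where "T = (\<lambda>b. if b then A else B)"
  have T: "T \<in> measurable (count_space UNIV) (subprob_algebra M)"
    using sets sub by (auto simp: T_def space_subprob_algebra)
  have two: "(\<integral>\<^sup>+b. h b \<partial>count_space UNIV) = h True + h False" for h :: "bool \<Rightarrow> ennreal"
    by (subst nn_integral_count_space_finite) (auto simp: UNIV_bool add.commute)
  have "D = count_space UNIV \<bind> T"
  proof (rule measure_eqI)
    show "sets D = sets (count_space UNIV \<bind> T)"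
      using sets by (subst sets_bind[of _ _ M]) (auto simp: T_def)
    fix X assume "X \<in> sets D"
    then have "X \<in> sets M" using sets by simp
    then show "emeasure D X = emeasure (count_space UNIV \<bind> T) X"
      using T by (simp add: emeasure_bind two sum T_def)
  qed
  then show ?thesis
    using nn_integral_bind[OF g T] by (simp add: two T_def)
qed

text \<open>
  Splitting off the first \<open>N\<close> terms bounds each partial sum \<open>t\<close> by \<open>N + q * t\<close>.
\<close>

lemma summable_block_contraction:
  fixes a :: "nat \<Rightarrow> real"
  assumes a: "\<And>n. 0 \<le> a n" "\<And>n. a n \<le> 1" and block: "\<And>n. a (n + N) \<le> q * a n" and q: "q < 1"
  shows "summable a"
proof (rule summableI_nonneg_bounded)
  fix k
  have split: "sum a {..<k + N} = sum a {..<N} + (\<Sum>n<k. a (n + N))"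
    by (induction k) (simp_all add: add_ac)
  have "sum a {..<k} \<le> sum a {..<k + N}" using a by (intro sum_mono2) auto
  also have "\<dots> \<le> (\<Sum>n<N. 1) + (\<Sum>n<k. q * a n)"
    unfolding split using a block by (intro add_mono sum_mono)
  also have "\<dots> = N + q * sum a {..<k}" by (simp add: sum_distrib_left)
  finally show "sum a {..<k} \<le> N / (1 - q)" using q by (simp add: field_simps)
qed (rule a)

text \<open>
  Each step from \<open>x\<close> can be split into a restart from \<open>\<nu>\<close>, of mass \<open>s x\<close>, and a residual
  sub-Markov step (Nummelin's splitting). The minorization is in one step and \<open>s\<close> may vanish, so that no power
  of the kernel has to be considered.
\<close>

locale minorized_kernel =
  fixes M :: "'a measure" and K :: "'a \<Rightarrow> 'a measure" and \<nu> :: "'a measure" and s :: "'a \<Rightarrow> ennreal"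
  assumes K [measurable]: "K \<in> measurable M (subprob_algebra M)"
    and prob_K: "\<And>x. x \<in> space M \<Longrightarrow> prob_space (K x)"
    and prob_\<nu>: "prob_space \<nu>" and sets_\<nu> [measurable_cong]: "sets \<nu> = sets M"
    and s [measurable]: "s \<in> borel_measurable M"
    and minorized: "\<And>x B. x \<in> space M \<Longrightarrow> B \<in> sets M \<Longrightarrow> s x * emeasure \<nu> B \<le> emeasure (K x) B"
begin

definition residual :: "'a \<Rightarrow> 'a measure" where
  "residual x = diff_measure (K x) (scale_measure (s x) \<nu>)"

definition residual_op :: "('a \<Rightarrow> ennreal) \<Rightarrow> 'a \<Rightarrow> ennreal" where
  "residual_op g x = (\<integral>\<^sup>+ y. g y \<partial>residual x)"

lemma sets_K: "x \<in> space M \<Longrightarrow> sets (K x) = sets M"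
  using K by (rule sets_kernel)

lemma space_\<nu>: "space \<nu> = space M"
  using sets_\<nu> by (rule sets_eq_imp_space_eq)

lemma emeasure_K_space: "x \<in> space M \<Longrightarrow> emeasure (K x) (space M) = 1"
  using prob_space.emeasure_space_1[OF prob_K] sets_eq_imp_space_eq[OF sets_K] by simp

lemma emeasure_\<nu>_space: "emeasure \<nu> (space M) = 1"
  using prob_space.emeasure_space_1[OF prob_\<nu>] by (simp add: space_\<nu>)

lemma s_le_1: "x \<in> space M \<Longrightarrow> s x \<le> 1"
  using minorized[of x "space M"] by (simp add: emeasure_K_space emeasure_\<nu>_space)

lemma sets_residual: "x \<in> space M \<Longrightarrow> sets (residual x) = sets M"
  by (simp add: residual_def sets_K)

lemma emeasure_residual:
  assumes x: "x \<in> space M" and B: "B \<in> sets M"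
  shows "emeasure (residual x) B = emeasure (K x) B - s x * emeasure \<nu> B"
proof -
  interpret Kx: prob_space "K x" using x by (rule prob_K)
  interpret \<nu>: prob_space \<nu> by (rule prob_\<nu>)
  have "finite_measure (scale_measure (s x) \<nu>)"
    using s_le_1[OF x] by (intro finite_measureI)
      (auto simp: ennreal_mult_eq_top_iff space_\<nu> emeasure_\<nu>_space top_unique)
  then show ?thesis
    unfolding residual_def using x B minorized
    by (subst emeasure_diff_measure) (auto simp: sets_K sets_\<nu> Kx.finite_measure_axioms)
qed

lemma subprob_residual: "x \<in> space M \<Longrightarrow> subprob_space (residual x)"
proof (rule subprob_spaceI)
  assume x: "x \<in> space M"
  have sp: "space (residual x) = space M" using sets_residual[OF x] by (rule sets_eq_imp_space_eq)
  show "emeasure (residual x) (space (residual x)) \<le> 1"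
    unfolding sp using x by (simp add: emeasure_residual emeasure_K_space)
  show "space (residual x) \<noteq> {}" using sp x by auto
qed

lemma residual_measurable [measurable]: "residual \<in> measurable M (subprob_algebra M)"
proof (rule measurable_subprob_algebra)
  fix B assume [measurable]: "B \<in> sets M"
  have "(\<lambda>x. emeasure (K x) B - s x * emeasure \<nu> B) \<in> borel_measurable M"
    by measurable
  then show "(\<lambda>x. emeasure (residual x) B) \<in> borel_measurable M"
    by (subst measurable_cong[OF emeasure_residual]) auto
qed (auto simp: sets_residual subprob_residual)

lemma kernel_split:
  assumes x: "x \<in> space M" and g: "g \<in> borel_measurable M"
  shows "(\<integral>\<^sup>+ y. g y \<partial>K x) = residual_op g x + s x * (\<integral>\<^sup>+ y. g y \<partial>\<nu>)"
proof -
  have "(\<integral>\<^sup>+ y. g y \<partial>K x) = (\<integral>\<^sup>+ y. g y \<partial>residual x) + (\<integral>\<^sup>+ y. g y \<partial>scale_measure (s x) \<nu>)"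
  proof (rule nn_integral_add_measure[where M = M])
    have "space (scale_measure (s x) \<nu>) = space M"
      by (rule sets_eq_imp_space_eq) (simp add: sets_\<nu>)
    then show "subprob_space (scale_measure (s x) \<nu>)"
      using x s_le_1[OF x] by (intro subprob_spaceI) (auto simp: emeasure_\<nu>_space)
    fix X assume X: "X \<in> sets M"
    show "emeasure (K x) X = emeasure (residual x) X + emeasure (scale_measure (s x) \<nu>) X"
      using X x minorized[OF x X] by (simp add: emeasure_residual diff_add_cancel_ennreal)
  qed (use x g in \<open>auto simp: sets_K sets_residual sets_\<nu> subprob_residual\<close>)
  moreover have "g \<in> borel_measurable \<nu>" using g by measurable
  ultimately show ?thesis by (simp add: residual_op_def nn_integral_scale_measure)
qed

lemma residual_op_measurable [measurable]: "g \<in> borel_measurable M \<Longrightarrow> residual_op g \<in> borel_measurable M"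
  unfolding residual_op_def
  by (rule measurable_compose[OF residual_measurable nn_integral_measurable_subprob_algebra])

lemma residual_op_pow_measurable [measurable]: "g \<in> borel_measurable M \<Longrightarrow> (residual_op ^^ n) g \<in> borel_measurable M"
  by (induction n) auto

lemma residual_op_mono:
  assumes "\<And>y. y \<in> space M \<Longrightarrow> g y \<le> h y" "x \<in> space M"
  shows "residual_op g x \<le> residual_op h x"
  unfolding residual_op_def using assms sets_eq_imp_space_eq[OF sets_residual[OF assms(2)]]
  by (intro nn_integral_mono) simp

lemma residual_op_pow_mono:
  assumes "\<And>y. y \<in> space M \<Longrightarrow> g y \<le> h y"
  shows "x \<in> space M \<Longrightarrow> (residual_op ^^ n) g x \<le> (residual_op ^^ n) h x"
  using assms by (induction n arbitrary: x) (auto intro: residual_op_mono)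

lemma residual_op_pow_cmult:
  assumes [measurable]: "g \<in> borel_measurable M"
  shows "x \<in> space M \<Longrightarrow> (residual_op ^^ n) (\<lambda>y. r * g y) x = r * (residual_op ^^ n) g x"
proof (induction n arbitrary: x)
  case (Suc n)
  have sp: "space (residual x) = space M" using sets_residual[OF Suc.prems] by (rule sets_eq_imp_space_eq)
  have [measurable]: "(residual_op ^^ n) g \<in> borel_measurable (residual x)"
    using residual_op_pow_measurable[OF assms] by (simp add: measurable_cong_sets[OF sets_residual[OF Suc.prems] refl])
  have "(residual_op ^^ Suc n) (\<lambda>y. r * g y) x = (\<integral>\<^sup>+ y. r * (residual_op ^^ n) g y \<partial>residual x)"
    unfolding funpow.simps o_def residual_op_def[of _ x] by (intro nn_integral_cong Suc.IH) (simp add: sp)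
  also have "\<dots> = r * (\<integral>\<^sup>+ y. (residual_op ^^ n) g y \<partial>residual x)" by (rule nn_integral_cmult) measurable
  also have "(\<integral>\<^sup>+ y. (residual_op ^^ n) g y \<partial>residual x) = (residual_op ^^ Suc n) g x"
    unfolding funpow.simps o_def residual_op_def[of _ x] ..
  finally show ?case .
qed simp

text \<open>
  The probability of no restart during the first \<open>n\<close> steps.
\<close>

definition survival :: "nat \<Rightarrow> 'a \<Rightarrow> ennreal" where
  "survival n = (residual_op ^^ n) (\<lambda>_. 1)"

lemma survival_0 [simp]: "survival 0 x = 1"
  by (simp add: survival_def)

lemma survival_measurable [measurable]: "survival n \<in> borel_measurable M"
  by (simp add: survival_def)

text \<open>
  This form, without subtraction, is the recursion through which continuity in the starting
  point is inherited.
\<close>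

lemma survival_Suc:
  assumes "x \<in> space M"
  shows "survival (Suc n) x + s x * (\<integral>\<^sup>+ y. survival n y \<partial>\<nu>) = (\<integral>\<^sup>+ y. survival n y \<partial>K x)"
  using kernel_split[OF assms survival_measurable, of n] by (simp add: survival_def)

lemma survival_Suc_le: "x \<in> space M \<Longrightarrow> survival (Suc n) x \<le> survival n x"
proof -
  have "residual_op (\<lambda>_. 1) y \<le> 1" if "y \<in> space M" for y
    using subprob_space.subprob_emeasure_le_1[OF subprob_residual[OF that]] by (simp add: residual_op_def)
  moreover have "(residual_op ^^ Suc n) (\<lambda>_. 1) = (residual_op ^^ n) (residual_op (\<lambda>_. 1))" by (simp only: funpow_swap1 funpow.simps o_def)
  ultimately show "x \<in> space M \<Longrightarrow> survival (Suc n) x \<le> survival n x"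
    unfolding survival_def using residual_op_pow_mono[of "residual_op (\<lambda>_. 1)" "\<lambda>_. 1" x n] by simp
qed

lemma survival_le_1: "x \<in> space M \<Longrightarrow> survival n x \<le> 1"
  by (induction n) (auto intro: order_trans[OF survival_Suc_le])

lemma survival_add_le:
  assumes bound: "\<And>y. y \<in> space M \<Longrightarrow> survival N y \<le> q" and x: "x \<in> space M"
  shows "survival (n + N) x \<le> q * survival n x"
proof -
  have "survival (n + N) x = (residual_op ^^ n) (survival N) x"
    by (simp add: survival_def funpow_add)
  also have "\<dots> \<le> (residual_op ^^ n) (\<lambda>y. q * 1) x"
    using bound x by (intro residual_op_pow_mono) auto
  also have "\<dots> = q * survival n x"
    using residual_op_pow_cmult[of "\<lambda>_. 1" x n q] x by (simp add: survival_def)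
  finally show ?thesis .
qed


lemma nn_integral_survival_le_1:
  assumes "prob_space \<eta>" "sets \<eta> = sets M"
  shows "(\<integral>\<^sup>+ x. survival n x \<partial>\<eta>) \<le> 1"
proof -
  have "space \<eta> = space M" using assms(2) by (rule sets_eq_imp_space_eq)
  then have "(\<integral>\<^sup>+ x. survival n x \<partial>\<eta>) \<le> (\<integral>\<^sup>+ x. 1 \<partial>\<eta>)"
    by (intro nn_integral_mono) (simp add: survival_le_1)
  also have "\<dots> = 1" using prob_space.emeasure_space_1[OF assms(1)] by simp
  finally show ?thesis .
qed

lemma nn_integral_survival_finite:
  assumes "prob_space \<eta>" "sets \<eta> = sets M"
  shows "(\<integral>\<^sup>+ x. survival n x \<partial>\<eta>) < \<top>"
  using nn_integral_survival_le_1[OF assms] by (rule le_less_trans) simp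

text \<open>
  The law of the \<open>n\<close>-th step of the chain started from \<open>\<nu>\<close>, restricted to the event that no
  restart has happened. Its sum over \<open>n\<close> is the expected occupation of one excursion.
\<close>

primrec excursion :: "nat \<Rightarrow> 'a measure" where
  "excursion 0 = \<nu>"
| "excursion (Suc n) = excursion n \<bind> residual"

lemma excursion_kernel: "excursion n \<in> space (subprob_algebra M)"
proof (induction n)
  case 0
  then show ?case
    by (simp add: space_subprob_algebra sets_\<nu> prob_space_imp_subprob_space[OF prob_\<nu>])
next
  case (Suc n)
  then have n: "sets (excursion n) = sets M" "subprob_space (excursion n)" by (auto simp: space_subprob_algebra)
  then have S': "residual \<in> measurable (excursion n) (subprob_algebra M)"
    using residual_measurable measurable_cong_sets by blast
  moreover have "space (excursion n) \<noteq> {}" using n(2) by (rule subprob_space.subprob_not_empty)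
  ultimately have "sets (excursion n \<bind> residual) = sets M"
    by (intro sets_bind sets_kernel[OF S'])
  then show ?case
    using subprob_space_bind[OF n(2) S'] by (simp add: space_subprob_algebra)
qed

lemma sets_excursion: "sets (excursion n) = sets M"
  using excursion_kernel[of n] by (simp add: space_subprob_algebra)

lemma nn_integral_excursion:
  assumes "g \<in> borel_measurable M"
  shows "(\<integral>\<^sup>+ x. g x \<partial>excursion n) = (\<integral>\<^sup>+ x. (residual_op ^^ n) g x \<partial>\<nu>)"
  using assms
proof (induction n arbitrary: g)
  case (Suc n)
  have "residual \<in> measurable (excursion n) (subprob_algebra M)"
    using residual_measurable measurable_cong_sets[OF sets_excursion refl] by blast
  then have "(\<integral>\<^sup>+ x. g x \<partial>excursion (Suc n)) = (\<integral>\<^sup>+ x. residual_op g x \<partial>excursion n)"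
    using nn_integral_bind[OF Suc.prems] by (simp add: residual_op_def)
  also have "\<dots> = (\<integral>\<^sup>+ x. (residual_op ^^ n) (residual_op g) x \<partial>\<nu>)"
    by (rule Suc.IH) (rule residual_op_measurable[OF Suc.prems])
  finally show ?case by (simp only: funpow_swap1 funpow.simps o_def)
qed simp

definition occupation :: "'a measure" where
  "occupation = count_space UNIV \<bind> excursion"

lemma excursion_measurable: "excursion \<in> measurable (count_space UNIV) (subprob_algebra M)"
  using excursion_kernel by (auto simp: measurable_count_space_eq1)

lemma sets_occupation: "sets occupation = sets M"
  unfolding occupation_def by (rule sets_bind) (auto simp: sets_excursion)

lemma nn_integral_occupation:
  assumes "g \<in> borel_measurable M"
  shows "(\<integral>\<^sup>+ x. g x \<partial>occupation) = (\<Sum>n. \<integral>\<^sup>+ x. (residual_op ^^ n) g x \<partial>\<nu>)"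
  unfolding occupation_def using assms
  by (simp add: nn_integral_bind[OF assms excursion_measurable] nn_integral_count_space_nat nn_integral_excursion)

end

text \<open>
  A restart within \<open>N\<close> steps has probability at least \<open>1 - q\<close> from everywhere, so excursions have
  finite mean length and the occupation measure is finite.
\<close>

locale regenerative_kernel = minorized_kernel +
  fixes N :: nat and q :: ennreal
  assumes q: "q < 1" and returns: "\<And>x. x \<in> space M \<Longrightarrow> survival N x \<le> q"
begin

lemma summable_survival:
  assumes \<eta>: "prob_space \<eta>" "sets \<eta> = sets M"
  shows "summable (\<lambda>n. enn2real (\<integral>\<^sup>+ x. survival n x \<partial>\<eta>))"
proof -
  have sp: "space \<eta> = space M" using \<eta>(2) by (rule sets_eq_imp_space_eq)
  define a where "a = (\<lambda>n. \<integral>\<^sup>+ x. survival n x \<partial>\<eta>)"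
  have a1: "a n \<le> 1" for n
    unfolding a_def using \<eta> by (rule nn_integral_survival_le_1)
  have block: "a (n + N) \<le> q * a n" for n
  proof -
    have "a (n + N) \<le> (\<integral>\<^sup>+ x. q * survival n x \<partial>\<eta>)"
      unfolding a_def by (intro nn_integral_mono survival_add_le returns) (simp_all add: sp)
    also have "\<dots> = q * a n"
      unfolding a_def by (intro nn_integral_cmult) (simp add: measurable_cong_sets[OF \<eta>(2) refl])
    finally show ?thesis .
  qed
  have q': "q < \<top>" using q by (rule less_trans) simp
  have "summable (\<lambda>n. enn2real (a n))"
  proof (rule summable_block_contraction)
    show "enn2real (a n) \<le> 1" for n using a1[of n] by (simp add: enn2real_leI)
    show "enn2real (a (n + N)) \<le> enn2real q * enn2real (a n)" for n
    proof -
      have "q * a n < \<top>" using q' a1[of n] by (simp add: ennreal_mult_less_top le_less_trans)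
      then show ?thesis
        using enn2real_mono[OF block] by (simp add: enn2real_mult)
    qed
    show "enn2real q < 1"
      using q by (cases q rule: ennreal_cases) (auto simp: ennreal_1[symmetric] ennreal_less_iff simp del: ennreal_1)
  qed simp
  then show ?thesis by (simp only: a_def)
qed

lemma survival_tendsto_0:
  assumes \<eta>: "prob_space \<eta>" "sets \<eta> = sets M"
  shows "(\<lambda>n. \<integral>\<^sup>+ x. survival n x \<partial>\<eta>) \<longlonglongrightarrow> 0"
proof -
  have "(\<lambda>n. ennreal (enn2real (\<integral>\<^sup>+ x. survival n x \<partial>\<eta>))) \<longlonglongrightarrow> ennreal 0"
    by (intro tendsto_ennrealI summable_LIMSEQ_zero summable_survival \<eta>)
  then show ?thesis using nn_integral_survival_finite[OF \<eta>] by (simp add: ennreal_enn2real)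
qed

lemma mass_occupation:
  shows "emeasure occupation (space M) = (\<Sum>n. \<integral>\<^sup>+ x. survival n x \<partial>\<nu>)"
    and "emeasure occupation (space M) < \<top>" and "1 \<le> emeasure occupation (space M)"
proof -
  have sp: "space occupation = space M" using sets_occupation by (rule sets_eq_imp_space_eq)
  show eq: "emeasure occupation (space M) = (\<Sum>n. \<integral>\<^sup>+ x. survival n x \<partial>\<nu>)"
    using nn_integral_occupation[of "\<lambda>_. 1"] by (simp add: survival_def sp)
  have "(\<Sum>n. \<integral>\<^sup>+ x. survival n x \<partial>\<nu>) =
      (\<Sum>n. ennreal (enn2real (\<integral>\<^sup>+ x. survival n x \<partial>\<nu>)))"
    by (intro suminf_cong ennreal_enn2real[symmetric] nn_integral_survival_finite prob_\<nu> sets_\<nu>)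
  also have "\<dots> < \<top>"
    unfolding less_top[symmetric]
    by (rule ennreal_suminf_neq_top[OF summable_survival[OF prob_\<nu> sets_\<nu>] enn2real_nonneg])
  finally show "emeasure occupation (space M) < \<top>" by (simp add: eq)
  have "1 = sum (\<lambda>n. \<integral>\<^sup>+ x. survival n x \<partial>\<nu>) {..<1}"
    by (simp add: space_\<nu> emeasure_\<nu>_space)
  also have "\<dots> \<le> (\<Sum>n. \<integral>\<^sup>+ x. survival n x \<partial>\<nu>)" by (intro sum_le_suminf) auto
  finally show "1 \<le> emeasure occupation (space M)" by (simp add: eq)
qed

text \<open>
  One more step of the chain shifts the sum over excursion times by one, which loses the initial
  term \<open>\<nu>\<close> and adds \<open>\<gamma> * \<nu>\<close>, where \<open>\<gamma>\<close> is the total restart mass. Comparing total masses,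
  which are finite, gives \<open>\<gamma> = 1\<close>.
\<close>

lemma occupation_invariant:
  assumes g: "g \<in> borel_measurable M"
  shows "(\<integral>\<^sup>+ x. \<integral>\<^sup>+ y. g y \<partial>K x \<partial>occupation) = (\<integral>\<^sup>+ x. g x \<partial>occupation)"
proof -
  have sp: "space occupation = space M" using sets_occupation by (rule sets_eq_imp_space_eq)
  define \<gamma> where "\<gamma> = (\<integral>\<^sup>+ x. s x \<partial>occupation)"
  have K_split: "(\<integral>\<^sup>+ x. \<integral>\<^sup>+ y. h y \<partial>K x \<partial>occupation) = (\<integral>\<^sup>+ x. residual_op h x \<partial>occupation) + \<gamma> * (\<integral>\<^sup>+ x. h x \<partial>\<nu>)"
    if h: "h \<in> borel_measurable M" for h
  proof -
    have m: "residual_op h \<in> borel_measurable occupation" "s \<in> borel_measurable occupation"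
      using residual_op_measurable[OF h] s by (simp_all add: measurable_cong_sets[OF sets_occupation refl])
    have "(\<integral>\<^sup>+ x. \<integral>\<^sup>+ y. h y \<partial>K x \<partial>occupation) = (\<integral>\<^sup>+ x. residual_op h x + s x * (\<integral>\<^sup>+ x. h x \<partial>\<nu>) \<partial>occupation)"
      by (intro nn_integral_cong kernel_split h) (simp add: sp)
    also have "\<dots> = (\<integral>\<^sup>+ x. residual_op h x \<partial>occupation) + (\<integral>\<^sup>+ x. s x * (\<integral>\<^sup>+ x. h x \<partial>\<nu>) \<partial>occupation)"
      using m by (intro nn_integral_add) auto
    also have "(\<integral>\<^sup>+ x. s x * (\<integral>\<^sup>+ x. h x \<partial>\<nu>) \<partial>occupation) = \<gamma> * (\<integral>\<^sup>+ x. h x \<partial>\<nu>)"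
      unfolding \<gamma>_def using m by (intro nn_integral_multc)
    finally show ?thesis .
  qed
  have shift: "(\<integral>\<^sup>+ x. h x \<partial>occupation) = (\<integral>\<^sup>+ x. residual_op h x \<partial>occupation) + (\<integral>\<^sup>+ x. h x \<partial>\<nu>)"
    if h: "h \<in> borel_measurable M" for h
  proof -
    have "(\<Sum>n. \<integral>\<^sup>+ x. (residual_op ^^ n) h x \<partial>\<nu>) =
        (\<Sum>n. \<integral>\<^sup>+ x. (residual_op ^^ (n + 1)) h x \<partial>\<nu>) + (\<Sum>n<1. \<integral>\<^sup>+ x. (residual_op ^^ n) h x \<partial>\<nu>)"
      by (rule suminf_offset) auto
    then show ?thesis
      unfolding nn_integral_occupation[OF h] nn_integral_occupation[OF residual_op_measurable[OF h]]
      by (simp add: funpow_swap1)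
  qed
  have "\<gamma> = 1"
  proof -
    have one: "(\<lambda>_. 1) \<in> borel_measurable M" by simp
    have \<nu>1: "(\<integral>\<^sup>+ x. 1 \<partial>\<nu>) = 1" by (simp add: space_\<nu> emeasure_\<nu>_space)
    have mass: "(\<integral>\<^sup>+ x. 1 \<partial>occupation) = emeasure occupation (space M)" by (simp add: sp)
    have "(\<integral>\<^sup>+ x. \<integral>\<^sup>+ y. 1 \<partial>K x \<partial>occupation) = (\<integral>\<^sup>+ x. 1 \<partial>occupation)"
      using prob_space.emeasure_space_1[OF prob_K] by (intro nn_integral_cong) (simp add: sp)
    then have eq: "(\<integral>\<^sup>+ x. residual_op (\<lambda>_. 1) x \<partial>occupation) + \<gamma> = (\<integral>\<^sup>+ x. residual_op (\<lambda>_. 1) x \<partial>occupation) + 1"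
      unfolding K_split[OF one] unfolding shift[OF one] unfolding \<nu>1 by (simp only: mult_1_right)
    have "(\<integral>\<^sup>+ x. residual_op (\<lambda>_. 1) x \<partial>occupation) \<le> emeasure occupation (space M)"
      unfolding mass[symmetric] unfolding shift[OF one] by simp
    then have "(\<integral>\<^sup>+ x. residual_op (\<lambda>_. 1) x \<partial>occupation) \<noteq> \<top>" using mass_occupation(2) by (auto simp: top_unique)
    with eq show ?thesis by (auto simp: ennreal_add_left_cancel)
  qed
  then show ?thesis unfolding K_split[OF g] shift[OF g] by simp
qed

definition cycle_measure :: "'a measure" where
  "cycle_measure = scale_measure (1 / emeasure occupation (space M)) occupation"

lemma sets_cycle_measure: "sets cycle_measure = sets M"
  by (simp add: cycle_measure_def sets_occupation)

lemma prob_cycle_measure: "prob_space cycle_measure"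
proof (rule prob_spaceI)
  have sp: "space cycle_measure = space M" using sets_cycle_measure by (rule sets_eq_imp_space_eq)
  have "emeasure cycle_measure (space M) = emeasure occupation (space M) / emeasure occupation (space M)"
    by (simp add: cycle_measure_def ennreal_divide_times)
  also have "\<dots> = 1"
  proof (rule ennreal_divide_self)
    show "emeasure occupation (space M) \<noteq> 0" using mass_occupation(3) by (intro notI) simp
    show "emeasure occupation (space M) < \<top>" by (rule mass_occupation(2))
  qed
  finally show "emeasure cycle_measure (space cycle_measure) = 1" by (simp only: sp)
qed

lemma stationary_cycle_measure: "stationary_for K M cycle_measure"
  unfolding stationary_for_def
proof (intro conjI ballI prob_cycle_measure sets_cycle_measure)
  fix B assume B: "B \<in> sets M"
  have sp: "space occupation = space M" using sets_occupation by (rule sets_eq_imp_space_eq)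
  have "(\<integral>\<^sup>+ x. \<integral>\<^sup>+ y. indicator B y \<partial>K x \<partial>occupation) = (\<integral>\<^sup>+ x. indicator B x \<partial>occupation)"
    using B by (intro occupation_invariant) simp
  also have "(\<integral>\<^sup>+ x. \<integral>\<^sup>+ y. indicator B y \<partial>K x \<partial>occupation) = (\<integral>\<^sup>+ x. emeasure (K x) B \<partial>occupation)"
    using B by (intro nn_integral_cong nn_integral_indicator) (simp add: sp sets_K)
  also have "(\<integral>\<^sup>+ x. indicator B x \<partial>occupation) = emeasure occupation B"
    using B by (intro nn_integral_indicator) (simp add: sets_occupation)
  finally have inv: "(\<integral>\<^sup>+ x. emeasure (K x) B \<partial>occupation) = emeasure occupation B" .
  have "(\<lambda>x. emeasure (K x) B) \<in> borel_measurable M" using B by measurable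
  then have "(\<lambda>x. emeasure (K x) B) \<in> borel_measurable occupation"
    by (simp add: measurable_cong_sets[OF sets_occupation refl])
  then show "emeasure cycle_measure B = (\<integral>\<^sup>+ x. emeasure (K x) B \<partial>cycle_measure)"
    by (simp add: cycle_measure_def nn_integral_scale_measure inv)
qed

text \<open>
  Iterating the splitting, a stationary \<open>\<eta>\<close> dominates \<open>\<gamma>\<close> times the first \<open>n\<close> terms of the occupation
  measure, where \<open>\<gamma>\<close> is the restart mass under \<open>\<eta>\<close>. The remainder has the mass of the
  survival probability, which tends to 0; hence \<open>\<gamma>\<close> is the normalizing factor, and a probability
  measure that dominates another one equals it.
\<close>

lemma stationary_unique:
  assumes \<eta>: "stationary_for K M \<eta>"
  shows "\<eta> = cycle_measure"
proof -
  have prob: "prob_space \<eta>" and sets: "sets \<eta> = sets M"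
    and inv: "\<And>B. B \<in> sets M \<Longrightarrow> emeasure \<eta> B = (\<integral>\<^sup>+ x. emeasure (K x) B \<partial>\<eta>)"
    using \<eta> unfolding stationary_for_def by blast+
  interpret \<eta>: prob_space \<eta> by (rule prob)
  have sp: "space \<eta> = space M" using sets by (rule sets_eq_imp_space_eq)
  have m: "h \<in> borel_measurable M \<Longrightarrow> h \<in> borel_measurable \<eta>" for h :: "'a \<Rightarrow> ennreal"
    by (simp add: measurable_cong_sets[OF sets refl])
  have K': "K \<in> measurable \<eta> (subprob_algebra M)"
    using K measurable_cong_sets[OF sets refl, of "subprob_algebra M"] by simp
  have fixed: "\<eta> = \<eta> \<bind> K"
  proof (rule measure_eqI)
    have "sets (\<eta> \<bind> K) = sets M"
      using \<eta>.not_empty by (intro sets_bind sets_kernel[OF K'])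
    then show "sets \<eta> = sets (\<eta> \<bind> K)" using sets by simp
    fix B assume "B \<in> sets \<eta>"
    then have B: "B \<in> sets M" using sets by simp
    show "emeasure \<eta> B = emeasure (\<eta> \<bind> K) B"
      unfolding emeasure_bind[OF \<eta>.not_empty K' B] by (rule inv[OF B])
  qed
  have ext: "(\<integral>\<^sup>+ x. h x \<partial>\<eta>) = (\<integral>\<^sup>+ x. \<integral>\<^sup>+ y. h y \<partial>K x \<partial>\<eta>)" if "h \<in> borel_measurable M" for h
    by (subst fixed) (rule nn_integral_bind[OF that K'])
  define \<gamma> where "\<gamma> = (\<integral>\<^sup>+ x. s x \<partial>\<eta>)"
  have step: "(\<integral>\<^sup>+ x. h x \<partial>\<eta>) = (\<integral>\<^sup>+ x. residual_op h x \<partial>\<eta>) + \<gamma> * (\<integral>\<^sup>+ x. h x \<partial>\<nu>)"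
    if h: "h \<in> borel_measurable M" for h
  proof -
    have "(\<integral>\<^sup>+ x. h x \<partial>\<eta>) = (\<integral>\<^sup>+ x. residual_op h x + s x * (\<integral>\<^sup>+ x. h x \<partial>\<nu>) \<partial>\<eta>)"
      unfolding ext[OF h] by (intro nn_integral_cong kernel_split h) (simp add: sp)
    also have "\<dots> = (\<integral>\<^sup>+ x. residual_op h x \<partial>\<eta>) + (\<integral>\<^sup>+ x. s x * (\<integral>\<^sup>+ x. h x \<partial>\<nu>) \<partial>\<eta>)"
      using m[OF residual_op_measurable[OF h]] m[OF s] by (intro nn_integral_add) auto
    also have "(\<integral>\<^sup>+ x. s x * (\<integral>\<^sup>+ x. h x \<partial>\<nu>) \<partial>\<eta>) = \<gamma> * (\<integral>\<^sup>+ x. h x \<partial>\<nu>)"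
      unfolding \<gamma>_def using m[OF s] by (intro nn_integral_multc)
    finally show ?thesis .
  qed
  have iterate: "(\<integral>\<^sup>+ x. h x \<partial>\<eta>) =
      (\<integral>\<^sup>+ x. (residual_op ^^ n) h x \<partial>\<eta>) + \<gamma> * (\<Sum>i<n. \<integral>\<^sup>+ x. (residual_op ^^ i) h x \<partial>\<nu>)"
    if h: "h \<in> borel_measurable M" for h n
  proof (induction n)
    case (Suc n)
    then show ?case
      using step[OF residual_op_pow_measurable[OF h, of n]] by (simp add: distrib_left add_ac)
  qed simp
  have \<gamma>_le: "\<gamma> \<le> 1"
  proof -
    have "\<gamma> \<le> (\<integral>\<^sup>+ x. 1 \<partial>\<eta>)"
      unfolding \<gamma>_def by (intro nn_integral_mono) (simp add: sp s_le_1)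
    then show ?thesis using \<eta>.emeasure_space_1 by simp
  qed
  have \<gamma>_fin: "\<gamma> < \<top>" using \<gamma>_le by (rule le_less_trans) simp
  have \<gamma>m: "\<gamma> * emeasure occupation (space M) = 1"
  proof -
    have "(\<lambda>n. (\<integral>\<^sup>+ x. survival n x \<partial>\<eta>) + \<gamma> * (\<Sum>i<n. \<integral>\<^sup>+ x. survival i x \<partial>\<nu>))
        \<longlonglongrightarrow> 0 + \<gamma> * (\<Sum>i. \<integral>\<^sup>+ x. survival i x \<partial>\<nu>)"
      by (intro tendsto_add survival_tendsto_0 prob sets ennreal_tendsto_cmult[OF \<gamma>_fin] summable_LIMSEQ) simp
    moreover have "(\<integral>\<^sup>+ x. survival n x \<partial>\<eta>) + \<gamma> * (\<Sum>i<n. \<integral>\<^sup>+ x. survival i x \<partial>\<nu>) = 1" for n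
      using iterate[of "\<lambda>_. 1" n] \<eta>.emeasure_space_1 by (simp add: survival_def)
    ultimately have "(\<lambda>n::nat. 1) \<longlonglongrightarrow> \<gamma> * (\<Sum>i. \<integral>\<^sup>+ x. survival i x \<partial>\<nu>)"
      by (simp only: add_0_left)
    then have "1 = \<gamma> * (\<Sum>i. \<integral>\<^sup>+ x. survival i x \<partial>\<nu>)"
      by (rule LIMSEQ_unique[OF tendsto_const])
    then show ?thesis by (simp only: mass_occupation(1))
  qed
  have dom: "emeasure cycle_measure B \<le> emeasure \<eta> B" if B: "B \<in> sets M" for B
  proof -
    have ind: "indicator B \<in> borel_measurable M" using B by simp
    have "\<gamma> * (\<Sum>i<n. \<integral>\<^sup>+ x. (residual_op ^^ i) (indicator B) x \<partial>\<nu>) \<le> emeasure \<eta> B" for n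
    proof -
      have "\<gamma> * (\<Sum>i<n. \<integral>\<^sup>+ x. (residual_op ^^ i) (indicator B) x \<partial>\<nu>) \<le> (\<integral>\<^sup>+ x. indicator B x \<partial>\<eta>)"
        unfolding iterate[OF ind, of n] by simp
      then show ?thesis using B by (simp add: sets)
    qed
    moreover have "(\<lambda>n. \<gamma> * (\<Sum>i<n. \<integral>\<^sup>+ x. (residual_op ^^ i) (indicator B) x \<partial>\<nu>))
        \<longlonglongrightarrow> \<gamma> * (\<Sum>i. \<integral>\<^sup>+ x. (residual_op ^^ i) (indicator B) x \<partial>\<nu>)"
      by (intro ennreal_tendsto_cmult[OF \<gamma>_fin] summable_LIMSEQ) simp
    ultimately have "\<gamma> * (\<Sum>i. \<integral>\<^sup>+ x. (residual_op ^^ i) (indicator B) x \<partial>\<nu>) \<le> emeasure \<eta> B"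
      by (intro LIMSEQ_le_const2[where X = "\<lambda>n. \<gamma> * (\<Sum>i<n. \<integral>\<^sup>+ x. (residual_op ^^ i) (indicator B) x \<partial>\<nu>)"]) simp_all
    moreover have "emeasure occupation B = (\<Sum>i. \<integral>\<^sup>+ x. (residual_op ^^ i) (indicator B) x \<partial>\<nu>)"
      using nn_integral_occupation[OF ind] B by (simp add: sets_occupation)
    moreover have "1 / emeasure occupation (space M) = \<gamma>"
    proof -
      have "1 / emeasure occupation (space M) = \<gamma> * emeasure occupation (space M) / emeasure occupation (space M)"
        by (simp only: \<gamma>m)
      also have "\<dots> = \<gamma>"
        using mass_occupation(2,3) by (intro mult_divide_eq_ennreal) auto
      finally show ?thesis .
    qed
    ultimately show ?thesis by (simp add: cycle_measure_def)
  qed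
  show ?thesis
  proof (rule measure_eqI)
    interpret cycle_measure: prob_space cycle_measure by (rule prob_cycle_measure)
    fix B assume "B \<in> sets \<eta>"
    then have B: "B \<in> sets M" by (simp add: sets)
    have spm: "space cycle_measure = space M" using sets_cycle_measure by (rule sets_eq_imp_space_eq)
    have "measure cycle_measure B \<le> measure \<eta> B" "measure cycle_measure (space M - B) \<le> measure \<eta> (space M - B)"
      using dom[of B] dom[of "space M - B"] B
      by (auto simp: cycle_measure.emeasure_eq_measure \<eta>.emeasure_eq_measure)
    moreover have "measure cycle_measure (space M - B) = 1 - measure cycle_measure B" "measure \<eta> (space M - B) = 1 - measure \<eta> B"
      using cycle_measure.prob_compl[of B] \<eta>.prob_compl[of B] B by (simp_all add: sets sets_cycle_measure sp spm)
    ultimately have "measure \<eta> B = measure cycle_measure B" by linarith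
    then show "emeasure \<eta> B = emeasure cycle_measure B"
      by (simp add: cycle_measure.emeasure_eq_measure \<eta>.emeasure_eq_measure)
  qed (simp add: sets sets_cycle_measure)
qed

end

section \<open>The noise kernel\<close>

lemma emeasure_noise:
  assumes "0 < \<epsilon>" "B \<in> sets borel"
  shows "emeasure (noise \<epsilon>) B = emeasure lborel ({-\<epsilon>..\<epsilon>} \<inter> B) / ennreal (2 * \<epsilon>)"
  unfolding noise_def using assms by (subst emeasure_uniform_measure) auto

lemma sets_noise [simp, measurable_cong]: "sets (noise \<epsilon>) = sets borel"
  by (simp add: noise_def)

lemma prob_noise: "0 < \<epsilon> \<Longrightarrow> prob_space (noise \<epsilon>)"
  unfolding noise_def by (rule prob_space_uniform_measure) auto

lemma noise_open_pos:
  assumes \<epsilon>: "0 < \<epsilon>" and W: "open W" "w \<in> W" "\<bar>w\<bar> \<le> \<epsilon>"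
  shows "0 < emeasure (noise \<epsilon>) W"
proof -
  obtain r where r: "0 < r" "ball w r \<subseteq> W" using W open_contains_ball by blast
  define p q where "p = max (- \<epsilon>) (w - r / 2)" and "q = min \<epsilon> (w + r / 2)"
  have pq: "p < q" "{p..q} \<subseteq> {-\<epsilon>..\<epsilon>}" using W(3) r(1) \<epsilon> by (auto simp: p_def q_def)
  have "{p..q} \<subseteq> ball w r"
    using r(1) by (auto simp: p_def q_def dist_real_def)
  then have "{p..q} \<subseteq> {-\<epsilon>..\<epsilon>} \<inter> W" using pq r by blast
  then have "emeasure lborel {p..q} \<le> emeasure lborel ({-\<epsilon>..\<epsilon>} \<inter> W)"
    using W(1) by (intro emeasure_mono) auto
  moreover have "0 < emeasure lborel {p..q}" using pq(1) by simp
  ultimately have "0 < emeasure lborel ({-\<epsilon>..\<epsilon>} \<inter> W)" by (rule less_le_trans[rotated])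
  then show ?thesis
    using \<epsilon> W(1) by (simp add: emeasure_noise ennreal_zero_less_divide)
qed

text \<open>
  Reachability enters the probabilistic part only through the assumption \<open>minimal\<close>.
\<close>

locale minimal_noisy_map =
  fixes f :: "circle \<Rightarrow> circle" and \<epsilon> :: real
  assumes cont: "continuous_on UNIV f" and \<epsilon>: "0 < \<epsilon>"
    and minimal: "\<And>A. A \<noteq> {} \<Longrightarrow> (\<And>x w. x \<in> A \<Longrightarrow> \<bar>w\<bar> \<le> \<epsilon> \<Longrightarrow> perturbed f w x \<in> A) \<Longrightarrow> A = UNIV"
begin

lemma f_measurable [measurable]: "f \<in> borel_measurable borel"
  by (rule borel_measurable_continuous_onI[OF cont])

lemma perturbed_measurable [measurable]:
  "(\<lambda>(x, w). perturbed f w x) \<in> borel_measurable (borel \<Otimes>\<^sub>M borel)"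
  unfolding perturbed_def by measurable

lemma perturbed_measurable_noise [measurable]: "(\<lambda>w. perturbed f w x) \<in> borel_measurable borel"
  unfolding perturbed_def by measurable

lemma continuous_perturbed_point: "continuous_on UNIV (\<lambda>x. perturbed f w x)"
  unfolding perturbed_def
  by (rule continuous_on_compose2[OF cont continuous_on_rotate]) simp

lemma continuous_perturbed_noise: "continuous_on UNIV (\<lambda>w. perturbed f w x)"
  unfolding perturbed_def
  by (rule continuous_on_compose2[OF cont continuous_on_compose2[OF continuous_on_circle_of[of UNIV]]])
     (auto intro: continuous_intros)

definition K :: "circle \<Rightarrow> circle measure" where
  "K x = distr (noise \<epsilon>) borel (\<lambda>w. perturbed f w x)"

lemma sets_K [simp]: "sets (K x) = sets borel"
  by (simp add: K_def)

lemma space_K [simp]: "space (K x) = UNIV"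
  by (simp add: K_def)

lemma prob_K: "prob_space (K x)"
  unfolding K_def by (rule prob_space.prob_space_distr[OF prob_noise[OF \<epsilon>]]) measurable

lemma K_kernel: "K \<in> measurable borel (subprob_algebra borel)"
  unfolding K_def
proof (rule measurable_distr2)
  show "(\<lambda>_. noise \<epsilon>) \<in> measurable borel (subprob_algebra borel)"
    by (rule measurable_const)
       (simp add: space_subprob_algebra prob_space_imp_subprob_space prob_noise \<epsilon>)
qed (rule perturbed_measurable)

lemma transition_eq_K:
  assumes "B \<in> sets borel"
  shows "transition f \<epsilon> x B = emeasure (K x) B"
proof -
  have m: "(\<lambda>w. perturbed f w x) -` B \<in> sets borel"
    using measurable_sets[OF perturbed_measurable_noise assms] by simp
  have sp: "space (noise \<epsilon>) = UNIV" by (simp add: noise_def)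
  have eq: "{w \<in> {-\<epsilon>..\<epsilon>}. perturbed f w x \<in> B} = {-\<epsilon>..\<epsilon>} \<inter> (\<lambda>w. perturbed f w x) -` B"
    by auto
  have "transition f \<epsilon> x B = emeasure (noise \<epsilon>) ((\<lambda>w. perturbed f w x) -` B)"
    unfolding transition_def eq using m \<epsilon> by (simp add: emeasure_noise)
  also have "\<dots> = emeasure (K x) B"
    unfolding K_def using assms by (subst emeasure_distr) (simp_all add: sp)
  finally show ?thesis .
qed

lemma stationary_iff: "stationary f \<epsilon> \<mu> \<longleftrightarrow> stationary_for K borel \<mu>"
  unfolding stationary_def stationary_for_def by (simp add: transition_eq_K)

lemma K_open_pos:
  assumes "open V" "perturbed f w x \<in> V" "\<bar>w\<bar> \<le> \<epsilon>"
  shows "0 < emeasure (K x) V"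
proof -
  have "open ((\<lambda>w. perturbed f w x) -` V)"
    using continuous_perturbed_noise \<open>open V\<close> by (rule open_vimage[rotated])
  then have "0 < emeasure (noise \<epsilon>) ((\<lambda>w. perturbed f w x) -` V)"
    by (rule noise_open_pos[OF \<epsilon>]) (use assms in auto)
  then show ?thesis
    unfolding K_def using \<open>open V\<close> by (subst emeasure_distr) (simp_all add: noise_def)
qed

lemma integral_K:
  fixes v :: "circle \<Rightarrow> real"
  assumes "continuous_on UNIV v"
  shows "(\<integral>y. v y \<partial>K x) = (\<integral>w. v (perturbed f w x) \<partial>noise \<epsilon>)"
  unfolding K_def
  using borel_measurable_continuous_onI[OF assms] by (intro integral_distr) measurable

text \<open>
  Dominated convergence, applied for each value of the noise separately.
\<close>

lemma feller:
  fixes v :: "circle \<Rightarrow> real"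
  assumes v: "continuous_on UNIV v" and bound: "\<And>y. \<bar>v y\<bar> \<le> 1"
  shows "continuous_on UNIV (\<lambda>x. \<integral>y. v y \<partial>K x)"
  unfolding continuous_on_sequentially
proof (intro allI ballI impI)
  fix X :: "nat \<Rightarrow> circle" and x
  assume X: "(\<forall>n. X n \<in> UNIV) \<and> X \<longlonglongrightarrow> x"
  interpret noise: prob_space "noise \<epsilon>" by (rule prob_noise[OF \<epsilon>])
  have [measurable]: "v \<in> borel_measurable borel" by (rule borel_measurable_continuous_onI[OF v])
  have "(\<lambda>n. \<integral>w. v (perturbed f w (X n)) \<partial>noise \<epsilon>) \<longlonglongrightarrow> (\<integral>w. v (perturbed f w x) \<partial>noise \<epsilon>)"
  proof (rule integral_dominated_convergence[where w = "\<lambda>_. 1"])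
    have "continuous_on UNIV (\<lambda>x. v (perturbed f w x))" for w
      using v continuous_perturbed_point by (rule continuous_on_compose2) simp
    then have "(\<lambda>n. v (perturbed f w (X n))) \<longlonglongrightarrow> v (perturbed f w x)" for w
      using X unfolding continuous_on_sequentially by (auto simp: o_def)
    then show "AE w in noise \<epsilon>. (\<lambda>n. v (perturbed f w (X n))) \<longlonglongrightarrow> v (perturbed f w x)" by simp
  qed (use bound in simp_all)
  then show "((\<lambda>x. \<integral>y. v y \<partial>K x) \<circ> X) \<longlonglongrightarrow> (\<integral>y. v y \<partial>K x)"
    by (simp add: o_def integral_K[OF v])
qed

section \<open>Uniform regeneration\<close>

definition x\<^sub>0 :: circle where "x\<^sub>0 = circle_of 0"

text \<open>
  At distance less than \<open>\<epsilon> / 2\<close> from \<open>x\<^sub>0\<close>, the window of noise around \<open>x\<close> contains the half-size window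
  around \<open>x\<^sub>0\<close>, with half its density; so any bump of height \<open>1 / 2\<close> and radius \<open>\<epsilon> / 2\<close>
  serves. It is continuous in order that the survival probabilities are.
\<close>

definition s :: "circle \<Rightarrow> real" where
  "s x = max 0 (1 / 2 - dist x x\<^sub>0 / \<epsilon>)"

definition \<nu> :: "circle measure" where
  "\<nu> = distr (noise (\<epsilon> / 2)) borel (\<lambda>w. perturbed f w x\<^sub>0)"

lemma prob_\<nu>: "prob_space \<nu>"
  unfolding \<nu>_def using \<epsilon> by (intro prob_space.prob_space_distr[OF prob_noise]) simp_all

lemma continuous_s: "continuous_on UNIV s"
  unfolding s_def[abs_def] by (intro continuous_intros) (use \<epsilon> in simp)

lemma kernel_minorized:
  assumes B: "B \<in> sets borel"
  shows "ennreal (s x) * emeasure \<nu> B \<le> emeasure (K x) B"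
proof (cases "dist x x\<^sub>0 < \<epsilon> / 2")
  case False
  then have "s x = 0" using \<epsilon> by (simp add: s_def field_simps)
  then show ?thesis by simp
next
  case True
  obtain \<delta> where \<delta>: "\<bar>\<delta>\<bar> = dist x x\<^sub>0" "x\<^sub>0 = circle_of (coord x + \<delta>)" by (rule dist_circle_lift)
  define G where "G = (\<lambda>w. perturbed f w x) -` B"
  have G: "G \<in> sets borel"
    unfolding G_def using measurable_sets[OF perturbed_measurable_noise B] by simp
  have sp: "space (noise r) = UNIV" for r by (simp add: noise_def)
  have \<delta>G: "(+) \<delta> -` G \<in> sets borel"
    using measurable_sets[of "(+) \<delta>" borel borel G] G by simp
  have shift: "(\<lambda>w. perturbed f w x\<^sub>0) -` B = (+) \<delta> -` G"
    by (auto simp: G_def perturbed_def \<delta>(2) add.assoc)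
  have "emeasure \<nu> B = emeasure (noise (\<epsilon> / 2)) ((+) \<delta> -` G)"
    unfolding \<nu>_def shift[symmetric] using B by (subst emeasure_distr) (simp_all add: sp)
  also have "\<dots> = emeasure lborel ({-\<epsilon>/2..\<epsilon>/2} \<inter> (+) \<delta> -` G) / ennreal \<epsilon>"
    using \<epsilon> \<delta>G by (simp add: emeasure_noise)
  also have "emeasure lborel ({-\<epsilon>/2..\<epsilon>/2} \<inter> (+) \<delta> -` G) =
      emeasure lborel ({\<delta> - \<epsilon>/2..\<delta> + \<epsilon>/2} \<inter> G)"
  proof -
    have "emeasure lborel ({\<delta> - \<epsilon>/2..\<delta> + \<epsilon>/2} \<inter> G) =
        emeasure (distr lborel borel ((+) \<delta>)) ({\<delta> - \<epsilon>/2..\<delta> + \<epsilon>/2} \<inter> G)"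
      by (simp only: lborel_distr_plus)
    also have "\<dots> = emeasure lborel ((+) \<delta> -` ({\<delta> - \<epsilon>/2..\<delta> + \<epsilon>/2} \<inter> G))"
      using G by (subst emeasure_distr) simp_all
    also have "(+) \<delta> -` ({\<delta> - \<epsilon>/2..\<delta> + \<epsilon>/2} \<inter> G) = {-\<epsilon>/2..\<epsilon>/2} \<inter> (+) \<delta> -` G"
      by auto
    finally show ?thesis by simp
  qed
  also have "\<dots> / ennreal \<epsilon> \<le> emeasure lborel ({-\<epsilon>..\<epsilon>} \<inter> G) / ennreal \<epsilon>"
  proof (rule divide_right_mono_ennreal)
    have "{\<delta> - \<epsilon>/2..\<delta> + \<epsilon>/2} \<subseteq> {-\<epsilon>..\<epsilon>}" using True \<delta>(1) by auto
    then show "emeasure lborel ({\<delta> - \<epsilon>/2..\<delta> + \<epsilon>/2} \<inter> G) \<le> emeasure lborel ({-\<epsilon>..\<epsilon>} \<inter> G)"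
      using G by (intro emeasure_mono) auto
  qed
  finally have le: "emeasure \<nu> B \<le> emeasure lborel ({-\<epsilon>..\<epsilon>} \<inter> G) / ennreal \<epsilon>" .
  have "0 \<le> dist x x\<^sub>0 / \<epsilon>" using \<epsilon> by simp
  then have "s x \<le> 1 / 2" unfolding s_def by linarith
  then have "ennreal (s x) * emeasure \<nu> B
      \<le> ennreal (1 / 2) * (emeasure lborel ({-\<epsilon>..\<epsilon>} \<inter> G) / ennreal \<epsilon>)"
    using le by (intro mult_mono ennreal_leI) auto
  also have "\<dots> = emeasure lborel ({-\<epsilon>..\<epsilon>} \<inter> G) / ennreal (2 * \<epsilon>)"
  proof -
    have "ennreal (1 / 2) * inverse (ennreal \<epsilon>) = inverse (ennreal (2 * \<epsilon>))"
    proof -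
      have "ennreal (1 / 2) * inverse (ennreal \<epsilon>) = ennreal (1 / 2 * inverse \<epsilon>)"
        unfolding inverse_ennreal[OF \<epsilon>] by (rule ennreal_mult[symmetric]) (use \<epsilon> in auto)
      also have "\<dots> = inverse (ennreal (2 * \<epsilon>))"
        using \<epsilon> by (subst inverse_ennreal) (simp_all add: field_simps)
      finally show ?thesis .
    qed
    then show ?thesis
      unfolding divide_ennreal_def by (metis mult.left_commute)
  qed
  also have "\<dots> = emeasure (noise \<epsilon>) G" using \<epsilon> G by (simp add: emeasure_noise)
  also have "\<dots> = emeasure (K x) B"
    unfolding K_def G_def using B by (subst emeasure_distr) (simp_all add: sp)
  finally show ?thesis .
qed

sublocale minorized: minorized_kernel borel K \<nu> "\<lambda>x. ennreal (s x)"
proof (rule minorized_kernel.intro)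
  show "(\<lambda>x. ennreal (s x)) \<in> borel_measurable borel"
    using borel_measurable_continuous_onI[OF continuous_s] by measurable
qed (simp_all add: K_kernel prob_K prob_\<nu> kernel_minorized, simp add: \<nu>_def)

lemma survival_continuous:
  "continuous_on UNIV (\<lambda>x. enn2real (minorized.survival n x))"
proof (induction n)
  case 0
  then show ?case by simp
next
  case (Suc n)
  define v where "v = (\<lambda>x. enn2real (minorized.survival n x))"
  have v: "continuous_on UNIV v" using Suc by (simp add: v_def)
  have v_eq: "minorized.survival n y = ennreal (v y)" for y
    using minorized.survival_le_1[of y n] by (simp add: v_def ennreal_enn2real le_less_trans[OF _ ennreal_one_less_top])
  have v01: "0 \<le> v y" "v y \<le> 1" for y
    using minorized.survival_le_1[of y n] by (simp_all add: v_def enn2real_leI)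
  have [measurable]: "v \<in> borel_measurable borel" by (rule borel_measurable_continuous_onI[OF v])
  have nn: "(\<integral>\<^sup>+ y. minorized.survival n y \<partial>\<eta>) = ennreal (\<integral>y. v y \<partial>\<eta>)"
    if "prob_space \<eta>" "sets \<eta> = sets borel" for \<eta>
  proof -
    interpret \<eta>: prob_space \<eta> by (rule that)
    have "v \<in> borel_measurable \<eta>" by (simp add: measurable_cong_sets[OF that(2) refl])
    then have "integrable \<eta> v" using v01 by (intro \<eta>.integrable_const_bound[of _ 1]) auto
    then show ?thesis unfolding v_eq using v01 by (intro nn_integral_eq_integral) auto
  qed
  define b where "b = (\<integral>y. v y \<partial>\<nu>)"
  have b0: "0 \<le> b" unfolding b_def using v01 by simp
  have "enn2real (minorized.survival (Suc n) x) = (\<integral>y. v y \<partial>K x) - s x * b" for x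
  proof -
    define u where "u = enn2real (minorized.survival (Suc n) x)"
    have u: "minorized.survival (Suc n) x = ennreal u" "0 \<le> u"
      using minorized.survival_le_1[of x "Suc n"]
      by (simp_all add: u_def ennreal_enn2real le_less_trans[OF _ ennreal_one_less_top])
    have s0: "0 \<le> s x" by (simp add: s_def)
    have I0: "0 \<le> (\<integral>y. v y \<partial>K x)" using v01 by simp
    have "ennreal u + ennreal (s x) * ennreal b = ennreal (\<integral>y. v y \<partial>K x)"
      using minorized.survival_Suc[of x n] nn[OF prob_K sets_K] nn[OF prob_\<nu> minorized.sets_\<nu>]
      by (simp add: u b_def)
    then have "ennreal (u + s x * b) = ennreal (\<integral>y. v y \<partial>K x)"
      using s0 b0 u(2) by (simp add: ennreal_mult)
    then have "u + s x * b = (\<integral>y. v y \<partial>K x)" using s0 b0 u(2) I0 by (subst (asm) ennreal_inj) auto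
    then show ?thesis by (simp add: u_def)
  qed
  then show ?case
    using feller[OF v] continuous_s v01 by (auto intro!: continuous_intros)
qed

lemma open_survival_less: "open {x. minorized.survival n x < 1}"
proof -
  have "minorized.survival n x < 1 \<longleftrightarrow> enn2real (minorized.survival n x) < 1" for x
  proof -
    have "ennreal (enn2real (minorized.survival n x)) = minorized.survival n x"
      using minorized.survival_le_1[of x n] by (simp add: le_less_trans[OF _ ennreal_one_less_top])
    then show ?thesis
      using ennreal_less_iff[of "enn2real (minorized.survival n x)" 1] by simp
  qed
  then have "{x. minorized.survival n x < 1} = {x. enn2real (minorized.survival n x) < 1}" by simp
  also have "open \<dots>"
    using survival_continuous by (intro open_Collect_less continuous_intros)
  finally show ?thesis .
qed

text \<open>
  From a point that never restarts almost surely, no reachable point can restart with positive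
  probability, since by continuity this would happen for an open set of noises. By minimality
  all points would have this property, even \<open>x\<^sub>0\<close>, where \<open>s\<close> is positive.
\<close>

lemma survival_eventually_less: "\<exists>n. minorized.survival n x < 1"
proof (rule ccontr)
  define Z where "Z = {x. \<forall>n. minorized.survival n x = 1}"
  assume "\<not> ?thesis"
  then have "x \<in> Z"
    using minorized.survival_le_1 by (auto simp: Z_def not_less intro: antisym)
  moreover have "perturbed f w y \<in> Z" if y: "y \<in> Z" and w: "\<bar>w\<bar> \<le> \<epsilon>" for y w
  proof (rule ccontr)
    assume "perturbed f w y \<notin> Z"
    then obtain n where n: "minorized.survival n (perturbed f w y) < 1"
      using minorized.survival_le_1 unfolding Z_def by (auto simp: less_le)
    interpret Ky: prob_space "K y" by (rule prob_K)
    define V where "V = {z. minorized.survival n z < 1}"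
    have V: "open V" unfolding V_def by (rule open_survival_less)
    have Vpos: "0 < emeasure (K y) V"
      by (rule K_open_pos[OF V _ w]) (simp add: V_def n)
    have [measurable]: "minorized.survival n \<in> borel_measurable (K y)"
      using minorized.survival_measurable by (simp add: measurable_cong_sets[OF sets_K refl])
    have "(\<integral>\<^sup>+ z. minorized.survival n z \<partial>K y) < (\<integral>\<^sup>+ z. 1 \<partial>K y)"
    proof (rule nn_integral_less)
      show "(\<integral>\<^sup>+ z. minorized.survival n z \<partial>K y) \<noteq> \<infinity>"
        using minorized.nn_integral_survival_finite[OF prob_K sets_K, of y n] by simp
      show "AE z in K y. minorized.survival n z \<le> 1"
        using minorized.survival_le_1 by simp
      show "\<not> (AE z in K y. 1 \<le> minorized.survival n z)"
      proof
        assume "AE z in K y. 1 \<le> minorized.survival n z"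
        then have "AE z in K y. z \<notin> V" by (simp add: V_def not_less)
        then have "emeasure (K y) V = 0"
          using V by (subst (asm) AE_iff_measurable[of V]) auto
        with Vpos show False by simp
      qed
    qed simp_all
    also have "\<dots> = 1" using Ky.emeasure_space_1 by simp
    finally have less: "(\<integral>\<^sup>+ z. minorized.survival n z \<partial>K y) < 1" .
    have "1 = minorized.survival (Suc n) y" using y by (simp add: Z_def)
    also have "\<dots> \<le> minorized.survival (Suc n) y + ennreal (s y) * (\<integral>\<^sup>+ z. minorized.survival n z \<partial>\<nu>)"
      by simp
    also have "\<dots> = (\<integral>\<^sup>+ z. minorized.survival n z \<partial>K y)"
      by (rule minorized.survival_Suc) simp
    finally show False using less by simp
  qed
  ultimately have "Z = UNIV" by (intro minimal) auto
  then have one: "minorized.survival 1 x\<^sub>0 = 1" by (auto simp: Z_def)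
  have "minorized.survival (Suc 0) x\<^sub>0 + ennreal (s x\<^sub>0) * (\<integral>\<^sup>+ z. minorized.survival 0 z \<partial>\<nu>) =
      (\<integral>\<^sup>+ z. minorized.survival 0 z \<partial>K x\<^sub>0)"
    by (rule minorized.survival_Suc) simp
  then have "1 + ennreal (s x\<^sub>0) = 1"
    using one prob_space.emeasure_space_1[OF prob_K, of x\<^sub>0] minorized.emeasure_\<nu>_space minorized.space_\<nu> by simp
  then have "ennreal (1 + s x\<^sub>0) = ennreal 1" by (simp add: s_def)
  then show False by (subst (asm) ennreal_inj) (simp_all add: s_def)
qed

text \<open>
  Survival decreases in time and is continuous in space, so compactness makes the restart time
  uniform and turns the strict inequality into a gap.
\<close>

lemma uniform_regeneration: "\<exists>N q. q < 1 \<and> (\<forall>x. minorized.survival N x \<le> q)"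
proof -
  have "UNIV \<subseteq> (\<Union>n. {x. minorized.survival n x < 1})"
    using survival_eventually_less by blast
  then obtain F where F: "finite F" "UNIV \<subseteq> (\<Union>n\<in>F. {x. minorized.survival n x < 1})"
    using compactE_image[OF compact_UNIV_circle, of UNIV] open_survival_less by (metis (no_types, lifting))
  define N where "N = Max (insert 0 F)"
  have anti: "minorized.survival (n + m) x \<le> minorized.survival n x" for n m x
    by (induction m) (auto intro: order_trans[OF minorized.survival_Suc_le])
  have less: "minorized.survival N x < 1" for x
  proof -
    obtain n where n: "n \<in> F" "minorized.survival n x < 1" using F(2) by blast
    have "n \<le> N" unfolding N_def using F(1) n(1) by (intro Max_ge) auto
    then show ?thesis using anti[of n "N - n" x] n(2) by simp
  qed
  have fin: "minorized.survival N x < \<top>" for x using less[of x] by (rule less_trans) simp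
  obtain z where z: "\<And>x. enn2real (minorized.survival N x) \<le> enn2real (minorized.survival N z)"
    using continuous_attains_sup[OF compact_UNIV_circle _ survival_continuous[of N]] by auto
  have "minorized.survival N x \<le> minorized.survival N z" for x
    using ennreal_leI[OF z[of x]] fin by (simp add: ennreal_enn2real)
  with less show ?thesis by blast
qed

lemma unique_stationary:
  obtains \<mu> where "stationary f \<epsilon> \<mu>" "\<And>\<mu>'. stationary f \<epsilon> \<mu>' \<Longrightarrow> \<mu>' = \<mu>"
proof -
  obtain N q where "q < 1" "\<And>x. minorized.survival N x \<le> q"
    using uniform_regeneration by blast
  then interpret regenerative_kernel borel K \<nu> "\<lambda>x. ennreal (s x)" N q
    by unfold_locales auto
  show ?thesis
    by (rule that[of cycle_measure]) (simp_all add: stationary_iff stationary_cycle_measure stationary_unique)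
qed

section \<open>Support and ergodicity\<close>

text \<open>
  If a neighbourhood \<open>V\<close> of an image point were null, then, by stationarity, so would be the open set of
  points from which the same noise leads to \<open>V\<close>. Hence the support is forward invariant. It is
  nonempty, for otherwise finitely many null sets would cover the circle.
\<close>

lemma support_UNIV:
  assumes "stationary f \<epsilon> \<mu>"
  shows "measure_support \<mu> = UNIV"
proof (rule minimal)
  have prob: "prob_space \<mu>" and sets: "sets \<mu> = sets borel"
    and inv: "\<And>B. B \<in> sets borel \<Longrightarrow> emeasure \<mu> B = (\<integral>\<^sup>+ x. emeasure (K x) B \<partial>\<mu>)"
    using assms unfolding stationary_iff stationary_for_def by blast+
  interpret \<mu>: prob_space \<mu> by (rule prob)
  have sp: "space \<mu> = UNIV" using sets_eq_imp_space_eq[OF sets] by simp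
  show "measure_support \<mu> \<noteq> {}"
  proof
    assume "measure_support \<mu> = {}"
    then have "\<forall>x. \<exists>U. open U \<and> x \<in> U \<and> emeasure \<mu> U = 0"
      unfolding measure_support_def by (simp add: set_eq_iff)
    then obtain U where U: "\<And>x. open (U x)" "\<And>x. x \<in> U x" "\<And>x. emeasure \<mu> (U x) = 0"
      by metis
    have "UNIV \<subseteq> (\<Union>x. U x)" using U(2) by blast
    then obtain F where F: "finite F" "UNIV \<subseteq> (\<Union>x\<in>F. U x)"
      using compactE_image[OF compact_UNIV_circle, of UNIV U] U(1) by auto
    have "emeasure \<mu> UNIV \<le> (\<Sum>x\<in>F. emeasure \<mu> (U x))"
    proof -
      have "emeasure \<mu> (\<Union>x\<in>F. U x) \<le> (\<Sum>x\<in>F. emeasure \<mu> (U x))"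
        using F(1) U(1) by (intro emeasure_subadditive_finite) (auto simp: sets)
      moreover have "(\<Union>x\<in>F. U x) = UNIV" using F(2) by blast
      ultimately show ?thesis by simp
    qed
    also have "\<dots> = 0" using U(3) by simp
    finally show False using \<mu>.emeasure_space_1 by (simp add: sp)
  qed
  fix x w assume x: "x \<in> measure_support \<mu>" and w: "\<bar>w\<bar> \<le> \<epsilon>"
  have "0 < emeasure \<mu> V" if V: "open V" "perturbed f w x \<in> V" for V
  proof (rule ccontr)
    assume "\<not> 0 < emeasure \<mu> V"
    then have "emeasure \<mu> V = 0" by simp
    then have "(\<integral>\<^sup>+ y. emeasure (K y) V \<partial>\<mu>) = 0" using inv[of V] V(1) by simp
    moreover have "(\<lambda>y. emeasure (K y) V) \<in> borel_measurable \<mu>"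
      using V(1) measurable_emeasure_kernel[OF K_kernel, of V]
      by (simp add: measurable_cong_sets[OF sets refl])
    ultimately have AE0: "AE y in \<mu>. emeasure (K y) V = 0"
      by (simp add: nn_integral_0_iff_AE)
    define V' where "V' = (\<lambda>y. perturbed f w y) -` V"
    have V': "open V'" "x \<in> V'"
      unfolding V'_def using continuous_perturbed_point V by (auto intro: open_vimage)
    have "y \<notin> V'" if "emeasure (K y) V = 0" for y
      using K_open_pos[OF V(1), of w y] that w by (auto simp: V'_def)
    with AE0 have "AE y in \<mu>. y \<notin> V'" by (auto elim: eventually_mono)
    then have "emeasure \<mu> V' = 0"
      using V'(1) by (subst (asm) AE_iff_measurable[of V']) (auto simp: sets sp)
    moreover have "0 < emeasure \<mu> V'" using x V' unfolding measure_support_def by blast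
    ultimately show False by simp
  qed
  then show "perturbed f w x \<in> measure_support \<mu>" unfolding measure_support_def by blast
qed

text \<open>
  Conditioning on an almost invariant set of positive measure gives another stationary measure.
\<close>

lemma unique_stationary_ergodic:
  assumes \<mu>: "stationary f \<epsilon> \<mu>" and unique: "\<And>\<mu>'. stationary f \<epsilon> \<mu>' \<Longrightarrow> \<mu>' = \<mu>"
  shows "ergodic_stationary f \<epsilon> \<mu>"
  unfolding ergodic_stationary_def
proof (intro conjI \<mu> ballI impI)
  have prob: "prob_space \<mu>" and sets: "sets \<mu> = sets borel"
    and inv: "\<And>B. B \<in> sets borel \<Longrightarrow> emeasure \<mu> B = (\<integral>\<^sup>+ x. emeasure (K x) B \<partial>\<mu>)"
    using \<mu> unfolding stationary_iff stationary_for_def by blast+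
  interpret \<mu>: prob_space \<mu> by (rule prob)
  fix B assume B: "B \<in> sets borel" and "AE x in \<mu>. transition f \<epsilon> x B = indicator B x"
  then have AE_B: "AE x in \<mu>. emeasure (K x) B = indicator B x" by (simp add: transition_eq_K)
  show "emeasure \<mu> B = 0 \<or> emeasure \<mu> B = 1"
  proof (rule disjCI)
    assume not1: "emeasure \<mu> B \<noteq> 1"
    show "emeasure \<mu> B = 0"
    proof (rule ccontr)
      assume B0: "emeasure \<mu> B \<noteq> 0"
      have B\<mu>: "B \<in> sets \<mu>" using B sets by simp
      define \<eta> where "\<eta> = uniform_measure \<mu> B"
      have \<eta>B: "emeasure \<eta> E = emeasure \<mu> (B \<inter> E) / emeasure \<mu> B" if "E \<in> sets borel" for E
        unfolding \<eta>_def using that B\<mu> sets by (intro emeasure_uniform_measure) auto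
      have "stationary_for K borel \<eta>"
        unfolding stationary_for_def
      proof (intro conjI ballI)
        show "prob_space \<eta>"
          unfolding \<eta>_def using B0 \<mu>.emeasure_finite by (intro prob_space_uniform_measure) auto
        show "sets \<eta> = sets borel" by (simp add: \<eta>_def sets)
        fix E :: "circle set" assume E: "E \<in> sets borel"
        have mE: "(\<lambda>y. emeasure (K y) E) \<in> borel_measurable \<mu>"
          using measurable_emeasure_kernel[OF K_kernel E]
          by (simp add: measurable_cong_sets[OF sets refl])
        have "emeasure (K x) (B \<inter> E) = emeasure (K x) E * indicator B x"
          if x: "emeasure (K x) B = indicator B x" for x
        proof (cases "x \<in> B")
          case True
          interpret Kx: prob_space "K x" by (rule prob_K)
          have "Kx.prob B = 1" using x True by (simp add: Kx.emeasure_eq_measure)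
          then have "AE y in K x. y \<in> B" using B by (subst (asm) Kx.prob_eq_1) auto
          then have "emeasure (K x) (B \<inter> E) = emeasure (K x) E"
            using B E by (intro emeasure_eq_AE) auto
          then show ?thesis using True by simp
        next
          case False
          have "emeasure (K x) (B \<inter> E) \<le> emeasure (K x) B" using B by (intro emeasure_mono) auto
          then show ?thesis using x False by simp
        qed
        then have "AE x in \<mu>. emeasure (K x) (B \<inter> E) = emeasure (K x) E * indicator B x"
          using AE_B by (auto elim: eventually_mono)
        then have "(\<integral>\<^sup>+ x. emeasure (K x) (B \<inter> E) \<partial>\<mu>) = (\<integral>\<^sup>+ x. emeasure (K x) E * indicator B x \<partial>\<mu>)"
          by (rule nn_integral_cong_AE)
        moreover have "emeasure \<mu> (B \<inter> E) = (\<integral>\<^sup>+ x. emeasure (K x) (B \<inter> E) \<partial>\<mu>)"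
          using B E by (intro inv) auto
        ultimately show "emeasure \<eta> E = (\<integral>\<^sup>+ x. emeasure (K x) E \<partial>\<eta>)"
          unfolding \<eta>B[OF E] unfolding \<eta>_def nn_integral_uniform_measure[OF mE B\<mu>] by simp
      qed
      then have "\<eta> = \<mu>" by (intro unique) (simp add: stationary_iff)
      moreover have "emeasure \<eta> B = 1"
        unfolding \<eta>B[OF B] Int_absorb using B0 \<mu>.emeasure_finite[of B] by (intro ennreal_divide_self) (simp_all add: less_top[symmetric])
      ultimately show False using not1 by simp
    qed
  qed
qed

end

section \<open>Noisy circle maps with large slope\<close>

lemma continuous_on_circle_lift:
  fixes h :: "circle \<Rightarrow> 'a::metric_space"
  assumes h: "continuous_on UNIV (\<lambda>t. h (circle_of t))"
  shows "continuous_on UNIV h"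
  unfolding continuous_on_iff
proof (intro ballI allI impI)
  fix x :: circle and e :: real assume "0 < e"
  then obtain d where d: "0 < d" "\<And>t. dist t (coord x) < d \<Longrightarrow> dist (h (circle_of t)) (h x) < e"
    using h[unfolded continuous_on_iff, rule_format, of "coord x" e] by (auto simp: circle_of_coord)
  have "dist (h y) (h x) < e" if "dist y x < d" for y
  proof -
    obtain \<delta> where \<delta>: "\<bar>\<delta>\<bar> = dist x y" "y = circle_of (coord x + \<delta>)" by (rule dist_circle_lift)
    then show ?thesis using d(2)[of "coord x + \<delta>"] that by (simp add: dist_real_def dist_commute)
  qed
  with d(1) show "\<exists>d>0. \<forall>y\<in>UNIV. dist y x < d \<longrightarrow> dist (h y) (h x) < e" by blast
qed

lemma continuous_circle_map:
  assumes "circle_C2 \<psi>"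
  shows "continuous_on UNIV (circle_map \<psi> L a)"
proof (rule continuous_on_circle_lift)
  have "continuous_on UNIV (\<lambda>t. \<psi> (circle_of t))"
    using deriv_circle_lift[of \<psi>] assms unfolding circle_C2_def
    by (meson DERIV_isCont continuous_at_imp_continuous_on)
  then have "continuous_on UNIV (\<lambda>t. L * \<psi> (circle_of t) + a)" by (intro continuous_intros)
  then show "continuous_on UNIV (\<lambda>t. circle_map \<psi> L a (circle_of t))"
    unfolding circle_map_def by (rule continuous_on_compose2[OF continuous_on_circle_of[of UNIV]]) simp
qed

theorem theorem1:
  fixes \<psi> :: "circle \<Rightarrow> real" and \<beta> c :: real
  assumes "circle_C2 \<psi>"
    and "finite (critical_set \<psi>)"
    and "\<And>x. x \<in> critical_set \<psi> \<Longrightarrow> circle_deriv (circle_deriv \<psi>) x \<noteq> 0"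
    and "0 < \<beta>" "\<beta> < 1" and "0 < c" "c < 1"
  shows "\<exists>L0>0. \<forall>L\<ge>L0. \<forall>(a::real) (k::nat) (\<epsilon>::real).
    0 \<le> a \<and> a < 1 \<and>
    (\<forall>x \<in> critical_set \<psi>. \<forall>l. 1 \<le> l \<and> l \<le> k \<longrightarrow>
       infdist ((circle_map \<psi> L a ^^ l) x) (critical_set \<psi>) \<ge> c) \<and>
    \<epsilon> > 0 \<and> \<epsilon> \<ge> L powr (- (real (2 * k + 1) * (1 - \<beta>))) \<longrightarrow>
    (\<exists>\<mu>. stationary (circle_map \<psi> L a) \<epsilon> \<mu> \<and>
       (\<forall>\<mu>'. stationary (circle_map \<psi> L a) \<epsilon> \<mu>' \<longrightarrow> \<mu>' = \<mu>) \<and>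
       ergodic_stationary (circle_map \<psi> L a) \<epsilon> \<mu> \<and>
       measure_support \<mu> = UNIV)"
proof (rule noisy_map_minimal[OF assms(1-4,6,7)])
  fix L0 assume L0: "1 \<le> L0"
    and minimal: "\<And>L a k \<epsilon> A. L0 \<le> L \<Longrightarrow>
      (\<And>x l. x \<in> critical_set \<psi> \<Longrightarrow> 1 \<le> l \<Longrightarrow> l \<le> k \<Longrightarrow>
        c \<le> infdist ((circle_map \<psi> L a ^^ l) x) (critical_set \<psi>)) \<Longrightarrow>
      L powr (- (real (2 * k + 1) * (1 - \<beta>))) \<le> \<epsilon> \<Longrightarrow>
      A \<noteq> {} \<Longrightarrow>
      (\<And>x w. x \<in> A \<Longrightarrow> \<bar>w\<bar> \<le> \<epsilon> \<Longrightarrow> perturbed (circle_map \<psi> L a) w x \<in> A) \<Longrightarrow>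
      A = UNIV"
  show ?thesis
  proof (intro exI[of _ L0] conjI allI impI)
    show "0 < L0" using L0 by simp
    fix L a \<epsilon> :: real and k :: nat
    assume "L0 \<le> L" and *: "0 \<le> a \<and> a < 1 \<and>
      (\<forall>x \<in> critical_set \<psi>. \<forall>l. 1 \<le> l \<and> l \<le> k \<longrightarrow>
         infdist ((circle_map \<psi> L a ^^ l) x) (critical_set \<psi>) \<ge> c) \<and>
      \<epsilon> > 0 \<and> \<epsilon> \<ge> L powr (- (real (2 * k + 1) * (1 - \<beta>)))"
    interpret minimal_noisy_map "circle_map \<psi> L a" \<epsilon>
    proof
      show "continuous_on UNIV (circle_map \<psi> L a)" using assms(1) by (rule continuous_circle_map)
      show "0 < \<epsilon>" using * by blast
      show "A = UNIV" if "A \<noteq> {}"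
        "\<And>x w. x \<in> A \<Longrightarrow> \<bar>w\<bar> \<le> \<epsilon> \<Longrightarrow> perturbed (circle_map \<psi> L a) w x \<in> A" for A
        by (rule minimal[OF \<open>L0 \<le> L\<close> _ _ that, where k = k and \<epsilon> = \<epsilon>]) (use * in blast)+
    qed
    obtain \<mu> where \<mu>: "stationary (circle_map \<psi> L a) \<epsilon> \<mu>"
      "\<And>\<mu>'. stationary (circle_map \<psi> L a) \<epsilon> \<mu>' \<Longrightarrow> \<mu>' = \<mu>"
      by (rule unique_stationary) rule
    then show "\<exists>\<mu>. stationary (circle_map \<psi> L a) \<epsilon> \<mu> \<and>
       (\<forall>\<mu>'. stationary (circle_map \<psi> L a) \<epsilon> \<mu>' \<longrightarrow> \<mu>' = \<mu>) \<and>
       ergodic_stationary (circle_map \<psi> L a) \<epsilon> \<mu> \<and>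
       measure_support \<mu> = UNIV"
      using unique_stationary_ergodic[OF \<mu>] support_UNIV[OF \<mu>(1)] by blast
  qed
qed

end
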